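(* Let $\varrho_D$ be a probability measure on the measurable subset $D\subset\mathbb{R}^d$ and let $H(K)$ be a separable reproducing kernel Hilbert space of complex-valued functions on $D$ with kernel $K$ such that $$\|K\|_\infty:=\sup_{\mathbf{x}\in D}\sqrt{K(\mathbf{x},\mathbf{x})}<\infty.$$ Let $n\in\mathbb{N}$ and let the nodes $\mathbf{X}=(\mathbf{x}^1,\dots,\mathbf{x}^n)$ be drawn randomly according to the product measure $(d\varrho_D(\mathbf{x}))^n$. Then for $0<t\le1$ $$\mathbb{P}\Big(\sup_{\|f\|_{H(K)}\le1}\Big|\int_D|f(\mathbf{x})|^2\,d\varrho_D(\mathbf{x})-\frac1n\sum_{i=1}^n|f(\mathbf{x}^i)|^2\Big|>t\,\|\mathrm{Id}\|_{K,2}^2\Big)\le2^{3/4}\,n\,\exp\Big(-\frac{n\,t^2\,\|\mathrm{Id}\|_{K,2}^2}{21\,\|K\|_\infty^2}\Big).$$ Moreover, for fixed $r>1$ and $n$ sufficiently large, namely $$\frac{n}{\log n}\ge\frac{21\,r\,\|K\|_\infty^2}{\|\mathrm{Id}\|_{K,2}^2},$$ one has $$\sup_{\|f\|_{H(K)}\le1}\Big|\int_D|f(\mathbf{x})|^2\,d\varrho_D(\mathbf{x})-\frac1n\sum_{i=1}^n|f(\mathbf{x}^i)|^2\Big|\le\|\mathrm{Id}\|_{K,2}\,\|K\|_\infty\sqrt{\frac{21\,r\log n}{n}}$$ with probability exceeding $1-2n^{1-r}$.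
   Context: $K:D\times D\to\mathbb{C}$ is a positive definite Hermitian kernel and $H(K)$, its reproducing kernel Hilbert space, is infinite-dimensional. $\|\mathrm{Id}\|_{K,2}$ denotes the operator norm of the embedding $\mathrm{Id}:H(K)\to L_2(D,\varrho_D)$. $\log$ is the natural logarithm; in the second part $n\ge2$, so that $n/\log n$ is defined. *)

theory Defs
  imports "HOL-Probability.Probability" "HOL-Library.Function_Algebras"
begin

text \<open>
  Complex-valued functions on a set \<open>D :: 'a set\<close> are represented as total functions
  \<open>'a \<Rightarrow> complex\<close> that vanish outside \<open>D\<close>; this makes the representation unique and
  lets the vector space operations be the pointwise ones.
\<close>

global_interpretation cfun: vector_space "\<lambda>(c::complex) (f::'a \<Rightarrow> complex) x. c * f x"
  by unfold_locales (auto simp: fun_eq_iff algebra_simps)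

text \<open>
  \<open>ip f g\<close> is the inner product of \<open>f, g \<in> H\<close>, linear in the first argument; its values outside
  \<open>H\<close> are irrelevant.
\<close>

definition ip_norm :: "(('a \<Rightarrow> complex) \<Rightarrow> ('a \<Rightarrow> complex) \<Rightarrow> complex) \<Rightarrow> ('a \<Rightarrow> complex) \<Rightarrow> real"
  where "ip_norm ip f = sqrt (Re (ip f f))"

text \<open>The case distinction is needed because \<open>Metric_space\<close> demands symmetry and nonnegativity
  on the whole type.\<close>

definition ip_dist ::
  "('a \<Rightarrow> complex) set \<Rightarrow> (('a \<Rightarrow> complex) \<Rightarrow> ('a \<Rightarrow> complex) \<Rightarrow> complex) \<Rightarrow>
     ('a \<Rightarrow> complex) \<Rightarrow> ('a \<Rightarrow> complex) \<Rightarrow> real"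
  where "ip_dist H ip f g = (if f \<in> H \<and> g \<in> H then ip_norm ip (f - g) else 0)"

locale inner_product_function_space =
  fixes D :: "'a set"
    and H :: "('a \<Rightarrow> complex) set"
    and ip :: "('a \<Rightarrow> complex) \<Rightarrow> ('a \<Rightarrow> complex) \<Rightarrow> complex"
  assumes subspace: "cfun.subspace H"
    and vanish_outside: "\<And>f x. f \<in> H \<Longrightarrow> x \<notin> D \<Longrightarrow> f x = 0"
    and ip_add: "\<And>f g h. f \<in> H \<Longrightarrow> g \<in> H \<Longrightarrow> h \<in> H \<Longrightarrow> ip (f + g) h = ip f h + ip g h"
    and ip_scale: "\<And>c f g. f \<in> H \<Longrightarrow> g \<in> H \<Longrightarrow> ip (\<lambda>x. c * f x) g = c * ip f g"
    and ip_cnj: "\<And>f g. f \<in> H \<Longrightarrow> g \<in> H \<Longrightarrow> ip f g = cnj (ip g f)"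
    and ip_nonneg: "\<And>f. f \<in> H \<Longrightarrow> 0 \<le> Re (ip f f)"
    and ip_definite: "\<And>f. f \<in> H \<Longrightarrow> ip f f = 0 \<Longrightarrow> f = 0"

locale hilbert_function_space = inner_product_function_space +
  assumes complete: "Metric_space.mcomplete H (ip_dist H ip)"

locale rkhs = hilbert_function_space D H ip
  for D :: "'a set"
    and H :: "('a \<Rightarrow> complex) set"
    and ip :: "('a \<Rightarrow> complex) \<Rightarrow> ('a \<Rightarrow> complex) \<Rightarrow> complex" +
  fixes K :: "'a \<Rightarrow> 'a \<Rightarrow> complex"
  assumes section_mem: "\<And>y. y \<in> D \<Longrightarrow> (\<lambda>x. if x \<in> D then K x y else 0) \<in> H"
    and reproducing: "\<And>f y. f \<in> H \<Longrightarrow> y \<in> D \<Longrightarrow> f y = ip f (\<lambda>x. if x \<in> D then K x y else 0)"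

text \<open>Positive definiteness is meant in the non-strict sense usual for reproducing kernels.\<close>

definition pos_def_hermitian_kernel :: "'a set \<Rightarrow> ('a \<Rightarrow> 'a \<Rightarrow> complex) \<Rightarrow> bool"
  where "pos_def_hermitian_kernel D K \<longleftrightarrow>
    (\<forall>x\<in>D. \<forall>y\<in>D. K x y = cnj (K y x)) \<and>
    (\<forall>S c. finite S \<longrightarrow> S \<subseteq> D \<longrightarrow> 0 \<le> Re (\<Sum>x\<in>S. \<Sum>y\<in>S. cnj (c x) * c y * K x y))"

definition infinite_dimensional :: "('a \<Rightarrow> complex) set \<Rightarrow> bool"
  where "infinite_dimensional H \<longleftrightarrow> \<not> (\<exists>B. finite B \<and> B \<subseteq> H \<and> cfun.span B = H)"

definition ip_separable ::
  "('a \<Rightarrow> complex) set \<Rightarrow> (('a \<Rightarrow> complex) \<Rightarrow> ('a \<Rightarrow> complex) \<Rightarrow> complex) \<Rightarrow> bool"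
  where "ip_separable H ip \<longleftrightarrow> separable_space (Metric_space.mtopology H (ip_dist H ip))"

definition unit_ball ::
  "('a \<Rightarrow> complex) set \<Rightarrow> (('a \<Rightarrow> complex) \<Rightarrow> ('a \<Rightarrow> complex) \<Rightarrow> complex) \<Rightarrow> ('a \<Rightarrow> complex) set"
  where "unit_ball H ip = {f \<in> H. ip_norm ip f \<le> 1}"

definition kernel_sup :: "'a set \<Rightarrow> ('a \<Rightarrow> 'a \<Rightarrow> complex) \<Rightarrow> real"
  where "kernel_sup D K = (SUP x\<in>D. sqrt (Re (K x x)))"

text \<open>The operator norm of the embedding of \<open>H\<close> into \<open>L\<^sub>2\<close>.\<close>

definition embedding_norm ::
  "('a \<Rightarrow> complex) set \<Rightarrow> (('a \<Rightarrow> complex) \<Rightarrow> ('a \<Rightarrow> complex) \<Rightarrow> complex) \<Rightarrow> 'a measure \<Rightarrow> real"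
  where "embedding_norm H ip \<rho> = (SUP f\<in>unit_ball H ip. sqrt (LINT x|\<rho>. (cmod (f x))\<^sup>2))"

definition worst_deviation ::
  "('a \<Rightarrow> complex) set \<Rightarrow> (('a \<Rightarrow> complex) \<Rightarrow> ('a \<Rightarrow> complex) \<Rightarrow> complex) \<Rightarrow> 'a measure \<Rightarrow>
     nat \<Rightarrow> (nat \<Rightarrow> 'a) \<Rightarrow> real"
  where "worst_deviation H ip \<rho> n X =
    (SUP f\<in>unit_ball H ip.
       \<bar>(LINT x|\<rho>. (cmod (f x))\<^sup>2) - 1 / real n * (\<Sum>i\<in>{1..n}. (cmod (f (X i)))\<^sup>2)\<bar>)"

abbreviation node_measure :: "nat \<Rightarrow> 'a measure \<Rightarrow> (nat \<Rightarrow> 'a) measure"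
  where "node_measure n \<rho> \<equiv> Pi\<^sub>M {1..n} (\<lambda>_. \<rho>)"

text \<open>The distance makes \<open>H\<close> a metric space, and the suprema above are finite (real-valued
  \<open>Sup\<close> would be arbitrary otherwise).\<close>

context inner_product_function_space
begin

lemma mem_add: "f \<in> H \<Longrightarrow> g \<in> H \<Longrightarrow> f + g \<in> H"
  and mem_scale: "f \<in> H \<Longrightarrow> (\<lambda>x. c * f x) \<in> H"
  and mem_zero: "0 \<in> H"
  and mem_diff: "f \<in> H \<Longrightarrow> g \<in> H \<Longrightarrow> f - g \<in> H"
  using subspace cfun.subspace_add cfun.subspace_scale cfun.subspace_0 cfun.subspace_diff
  by blast+

lemma ip_add_right: "f \<in> H \<Longrightarrow> g \<in> H \<Longrightarrow> h \<in> H \<Longrightarrow> ip h (f + g) = ip h f + ip h g"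
  by (metis ip_add ip_cnj complex_cnj_add mem_add)

lemma ip_scale_right: "f \<in> H \<Longrightarrow> g \<in> H \<Longrightarrow> ip g (\<lambda>x. c * f x) = cnj c * ip g f"
  by (metis ip_scale ip_cnj complex_cnj_mult mem_scale)

lemma ip_self: "f \<in> H \<Longrightarrow> ip f f = complex_of_real (Re (ip f f))"
  using ip_cnj[of f f] by (simp add: complex_eq_iff)

lemma ip_zero_left: "g \<in> H \<Longrightarrow> ip 0 g = 0"
  using ip_scale[of 0 g 0] mem_zero by (simp add: zero_fun_def)

lemma Cauchy_Schwarz:
  assumes f: "f \<in> H" and g: "g \<in> H"
  shows "cmod (ip f g) \<le> ip_norm ip f * ip_norm ip g"
proof (cases "g = 0")
  case True
  then have "ip f g = 0"
    using ip_cnj[OF f g] ip_zero_left[OF f] by simp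
  then show ?thesis
    using f g ip_nonneg by (simp add: ip_norm_def)
next
  case False
  define a where "a = ip f g"
  define G where "G = Re (ip g g)"
  have gg: "ip g g = complex_of_real G"
    using ip_self[OF g] by (simp add: G_def)
  have G: "G > 0"
    using False ip_definite[OF g] ip_nonneg[OF g] gg G_def
    by (metis less_eq_real_def of_real_0)
  have gf: "ip g f = cnj a"
    using ip_cnj[OF g f] by (simp add: a_def)
  define c where "c = - a / complex_of_real G"
  define h where "h = f + (\<lambda>x. c * g x)"
  have cg: "(\<lambda>x. c * g x) \<in> H" using mem_scale[OF g] .
  have hH: "h \<in> H" using mem_add[OF f cg] by (simp add: h_def)
  have "ip h h = ip f f + cnj c * a + c * (cnj a + cnj c * complex_of_real G)"
    using f g cg hH gf gg
    by (simp add: h_def ip_add ip_add_right ip_scale ip_scale_right mem_add a_def algebra_simps)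
  also have "cnj a + cnj c * complex_of_real G = 0"
    using G by (simp add: c_def)
  also have "cnj c * a = - complex_of_real ((cmod a)\<^sup>2 / G)"
    unfolding c_def of_real_divide complex_norm_square by (simp add: mult.commute)
  finally have "ip h h = ip f f - complex_of_real ((cmod a)\<^sup>2 / G)" by simp
  then have "(cmod a)\<^sup>2 / G \<le> Re (ip f f)"
    using ip_nonneg[OF hH] by simp
  then have "(cmod a)\<^sup>2 \<le> Re (ip f f) * G"
    using G by (simp add: divide_simps)
  then have "cmod a \<le> sqrt (Re (ip f f) * G)"
    by (rule real_le_rsqrt)
  then show ?thesis
    by (simp add: a_def ip_norm_def G_def real_sqrt_mult)
qed

lemma ip_norm_triangle:
  assumes f: "f \<in> H" and g: "g \<in> H"
  shows "ip_norm ip (f + g) \<le> ip_norm ip f + ip_norm ip g"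
proof -
  have nn: "0 \<le> ip_norm ip f" "0 \<le> ip_norm ip g"
    using f g ip_nonneg by (auto simp: ip_norm_def)
  have "Re (ip (f + g) (f + g)) = Re (ip f f) + Re (ip g g) + Re (ip f g) + Re (ip g f)"
    using f g by (simp add: ip_add ip_add_right mem_add)
  also have "\<dots> \<le> (ip_norm ip f)\<^sup>2 + (ip_norm ip g)\<^sup>2 + 2 * (ip_norm ip f * ip_norm ip g)"
    using Cauchy_Schwarz[OF f g] Cauchy_Schwarz[OF g f] ip_nonneg f g
      complex_Re_le_cmod[of "ip f g"] complex_Re_le_cmod[of "ip g f"]
    by (simp add: ip_norm_def mult.commute)
  also have "\<dots> = (ip_norm ip f + ip_norm ip g)\<^sup>2"
    by (simp add: power2_sum)
  finally show ?thesis
    unfolding ip_norm_def[of ip "f + g"] using nn by (intro real_le_lsqrt) auto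
qed

lemma ip_norm_minus_commute:
  assumes "f \<in> H" "g \<in> H"
  shows "ip_norm ip (f - g) = ip_norm ip (g - f)"
proof -
  have "f - g = (\<lambda>x. -1 * (g - f) x)" by (auto simp: fun_eq_iff)
  then have "ip (f - g) (f - g) = ip (g - f) (g - f)"
    using ip_scale[of "g - f" "\<lambda>x. -1 * (g - f) x" "-1"] ip_scale_right[of "g - f" "g - f" "-1"]
      mem_diff[OF assms(2,1)] mem_scale[OF mem_diff[OF assms(2,1)], of "-1"] by simp
  then show ?thesis by (simp add: ip_norm_def)
qed

lemma Metric_space_ip_dist: "Metric_space H (ip_dist H ip)"
proof
  show "0 \<le> ip_dist H ip f g" for f g
    using ip_nonneg mem_diff by (simp add: ip_dist_def ip_norm_def)
  show "ip_dist H ip f g = ip_dist H ip g f" for f g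
    using ip_norm_minus_commute by (auto simp: ip_dist_def)
  show "ip_dist H ip f g = 0 \<longleftrightarrow> f = g" if "f \<in> H" "g \<in> H" for f g
  proof -
    have "Re (ip (f - g) (f - g)) = 0 \<longleftrightarrow> f - g = 0"
      using ip_definite[OF mem_diff[OF that]] ip_self[OF mem_diff[OF that]]
        ip_zero_left[OF mem_zero] by (metis of_real_0 zero_complex.sel(1))
    then show ?thesis
      using that by (simp add: ip_dist_def ip_norm_def)
  qed
  show "ip_dist H ip f h \<le> ip_dist H ip f g + ip_dist H ip g h"
    if "f \<in> H" "g \<in> H" "h \<in> H" for f g h
    using that ip_norm_triangle[OF mem_diff[of f g] mem_diff[of g h]]
    by (simp add: ip_dist_def)
qed

end

context rkhs
begin

lemma norm_le_kernel_sup: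
  assumes bdd: "bdd_above ((\<lambda>x. sqrt (Re (K x x))) ` D)"
    and f: "f \<in> unit_ball H ip" and x: "x \<in> D"
  shows "cmod (f x) \<le> kernel_sup D K"
proof -
  let ?k = "\<lambda>z. if z \<in> D then K z x else 0"
  have fH: "f \<in> H" and f1: "ip_norm ip f \<le> 1" using f by (auto simp: unit_ball_def)
  have "cmod (f x) = cmod (ip f ?k)" using reproducing[OF fH x] by simp
  also have "\<dots> \<le> ip_norm ip f * ip_norm ip ?k"
    by (rule Cauchy_Schwarz[OF fH section_mem[OF x]])
  also have "\<dots> \<le> 1 * ip_norm ip ?k"
    using f1 ip_nonneg[OF section_mem[OF x]] by (intro mult_right_mono) (auto simp: ip_norm_def)
  also have "ip_norm ip ?k = sqrt (Re (K x x))"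
    using reproducing[OF section_mem[OF x] x] x by (simp add: ip_norm_def)
  also have "1 * \<dots> \<le> kernel_sup D K"
    unfolding kernel_sup_def using cSUP_upper[OF x bdd] by simp
  finally show ?thesis .
qed

end

end

theory Submission
  imports Defs
begin

text \<open>
  Write \<open>k_x\<close> for the kernel section at \<open>x\<close>, so that \<open>|f x|\<^sup>2 = |<f, k_x>|\<^sup>2\<close>. By symmetrization with
  a ghost sample, the \<open>2p\<close>-th moment of the worst deviation \<open>Z\<close> is controlled by the moments of the
  random quadratic forms of \<open>A\<^sub>\<epsilon> = \<Sum>\<^sub>i \<epsilon>\<^sub>i k_{x\<^sub>i} \<otimes> k_{x\<^sub>i}\<close> with random signs \<open>\<epsilon>\<close>. These operators have
  rank at most \<open>n\<close>, and a noncommutative Khintchine inequality bounds the average of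
  \<open>tr A\<^sub>\<epsilon>^(2p)\<close> by \<open>(2p-1)!! n (\<parallel>K\<parallel>\<^sup>2 s)^p\<close>, where \<open>s \<le> n (\<parallel>Id\<parallel>\<^sup>2 + Z)\<close> is the norm of
  \<open>\<Sum>\<^sub>i k_{x\<^sub>i} \<otimes> k_{x\<^sub>i}\<close>. The resulting self-bounding inequality for the moments of \<open>Z\<close>, Markov's
  inequality and the choice \<open>p \<approx> n t\<^sup>2 \<parallel>Id\<parallel>\<^sup>2 / (16 \<parallel>K\<parallel>\<^sup>2)\<close> give the tail bound; the gap between
  \<open>16\<close> and \<open>21\<close> absorbs all remaining factors, because the claim is trivial unless
  \<open>n t\<^sup>2 \<parallel>Id\<parallel>\<^sup>2 / \<parallel>K\<parallel>\<^sup>2 \<ge> 21 ln (2^(3/4) n)\<close>.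
\<close>

text \<open>No spectral theorem is invoked: an operator \<open>A\<close> is seen only through the
  scalars \<open><A^m f, f>\<close>, and of these only Cauchy-Schwarz is used. Traces of even powers
  replace the operator norm because they can be averaged over one sign at a time: flipping a sign is
  a rank-one change, so the difference of the \<open>m\<close>-th powers telescopes into products of
  scalar moments, which commute although the operators do not. This is a discrete Gaussian
  integration by parts, hence the Gaussian moments \<open>(2p-1)!!\<close>. Taking the trace over at
  most \<open>n\<close> orthonormal vectors puts \<open>n\<close> where the dimension of the space
  would stand. The constants: symmetrization costs \<open>4^p\<close>, separating
  \<open>\<parallel>Id\<parallel>^2\<close> from \<open>Z\<close> costs \<open>2^p\<close>, and
  \<open>(2p-1)!!\<close> is about \<open>(2p/e)^p\<close>. With \<open>y = n t^2
  \<parallel>Id\<parallel>^2 / \<parallel>K\<parallel>^2\<close> the product is about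
  \<open>(16p/(ey))^p\<close>, smallest at \<open>p = y/16\<close> with value
  \<open>exp (-y/16)\<close>. A separate obstacle is measurability of a supremum over an uncountable
  ball; separability reduces it to a countable set that is uniformly dense.\<close>

subsection \<open>Moment sequences and double factorials\<close>

text \<open>The increments of a convex sequence grow, so the first \<open>k\<close> of them add up
  to no more than the last \<open>k\<close>; telescoping both sums gives the claim.\<close>

lemma convex_seq_reflect_le:
  fixes h :: "nat \<Rightarrow> real"
  assumes conv: "\<And>j. Suc j < r \<Longrightarrow> 2 * h (Suc j) \<le> h j + h (Suc (Suc j))" and "k \<le> r"
  shows "h k + h (r - k) \<le> h 0 + h r"
proof -
  have incr: "h (Suc i) - h i \<le> h (Suc (i + d)) - h (i + d)" if "i + d < r" for i d
    using that
  proof (induction d)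
    case (Suc d)
    then show ?case using conv[of "i + d"] by simp
  qed simp
  have "h k - h 0 = (\<Sum>j<k. h (Suc j) - h j)" by (simp add: sum_lessThan_telescope)
  also have "\<dots> \<le> (\<Sum>j<k. h (Suc (j + (r - k))) - h (j + (r - k)))"
    using \<open>k \<le> r\<close> by (intro sum_mono incr) auto
  also have "\<dots> = h r - h (r - k)"
    using sum_lessThan_telescope[of "\<lambda>j. h (j + (r - k))" k] \<open>k \<le> r\<close> by simp
  finally show ?thesis by simp
qed

lemma abs_le_mean_of_square_le_mult:
  fixes x y z :: real
  assumes "z\<^sup>2 \<le> x * y" "0 \<le> x" "0 \<le> y"
  shows "2 * \<bar>z\<bar> \<le> x + y"
proof (rule power2_le_imp_le)
  have "(2 * \<bar>z\<bar>)\<^sup>2 \<le> 4 * (x * y)" using assms by (simp add: power_mult_distrib)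
  also have "\<dots> \<le> (x + y)\<^sup>2" using zero_le_power2[of "x - y"] by (simp add: power2_eq_square algebra_simps)
  finally show "(2 * \<bar>z\<bar>)\<^sup>2 \<le> (x + y)\<^sup>2" .
qed (use assms in auto)

text \<open>Imitates the moments of a positive measure on the line, such as the spectral measure of
  a self-adjoint operator at a vector. Only conditions on 2 by 2 minors of the Hankel matrix are
  kept.\<close>

definition moment_seq :: "(nat \<Rightarrow> real) \<Rightarrow> bool"
  where "moment_seq a \<longleftrightarrow> (\<forall>j. 0 \<le> a (2 * j)) \<and> (\<forall>j k. (a (j + k))\<^sup>2 \<le> a (2 * j) * a (2 * k))"

lemma moment_seq_even_nonneg: "moment_seq a \<Longrightarrow> 0 \<le> a (2 * j)"
  and moment_seq_CS: "moment_seq a \<Longrightarrow> (a (j + k))\<^sup>2 \<le> a (2 * j) * a (2 * k)"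
  by (auto simp: moment_seq_def)

text \<open>By log-convexity of both sequences, \<open>k \<mapsto> a (2 k) * b (2 (r - k))\<close> is convex, so its sum over
  a pair of reflected indices is largest at the ends; odd indices are interpolated.\<close>

lemma moment_seq_cross_le:
  assumes a: "moment_seq a" and b: "moment_seq b" and q: "q \<le> 2 * r"
  shows "\<bar>a q * b (2 * r - q)\<bar> + \<bar>a (2 * r - q) * b q\<bar> \<le> a 0 * b (2 * r) + a (2 * r) * b 0"
proof -
  define h where "h k = a (2 * k) * b (2 * (r - k))" for k
  have h0: "0 \<le> h k" for k
    unfolding h_def by (intro mult_nonneg_nonneg moment_seq_even_nonneg a b)
  \<comment> \<open>The factors are paired crosswise, \<open>j\<close> with \<open>k'\<close> and
    \<open>k\<close> with \<open>j'\<close>, so that in each use below both products have total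
    index \<open>2 * r\<close>.\<close>
  have sq: "(a (j + k) * b (j' + k'))\<^sup>2 \<le> (a (2 * j) * b (2 * k')) * (a (2 * k) * b (2 * j'))" for j k j' k'
    using mult_mono[OF moment_seq_CS[OF a, of j k] moment_seq_CS[OF b, of j' k']]
      moment_seq_even_nonneg[OF a] by (simp add: power_mult_distrib algebra_simps)
  have conv: "2 * h (Suc j) \<le> h j + h (Suc (Suc j))" if "Suc j < r" for j
  proof -
    have "(h (Suc j))\<^sup>2 \<le> h j * h (Suc (Suc j))"
      using sq[of j "Suc (Suc j)" "r - Suc (Suc j)" "r - j"] that
      by (simp add: h_def algebra_simps eval_nat_numeral Suc_diff_Suc) 
    from abs_le_mean_of_square_le_mult[OF this h0 h0] show ?thesis by simp
  qed
  have refl: "h k + h (r - k) \<le> h 0 + h r" if "k \<le> r" for k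
    using convex_seq_reflect_le[of r h k] conv that by blast
  show ?thesis
  proof (cases "even q")
    case True
    then obtain k where k: "q = 2 * k" by blast
    then have "k \<le> r" using q by simp
    moreover have "2 * r - q = 2 * (r - k)" using k by simp
    ultimately show ?thesis
      using refl[of k] h0[of k] h0[of "r - k"] unfolding h_def k by simp
  next
    case False
    then obtain k where k: "q = Suc (2 * k)" by (metis oddE Suc_eq_plus1)
    then have kr: "k < r" using q by simp
    then obtain d where d: "r = Suc (k + d)" by (metis less_iff_Suc_add)
    have sub: "2 * r - q = Suc (2 * d)" "r - k = Suc d" "r - Suc k = d" by (simp_all add: k d)
    have 1: "2 * \<bar>a q * b (Suc (2 * d))\<bar> \<le> h k + h (Suc k)"
      using sq[of k "Suc k" d "Suc d"]
      by (intro abs_le_mean_of_square_le_mult h0) (simp add: h_def sub(2,3) k mult_2)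
    have 2: "2 * \<bar>a (Suc (2 * d)) * b q\<bar> \<le> h d + h (Suc d)"
      using sq[of d "Suc d" k "Suc k"]
      by (intro abs_le_mean_of_square_le_mult h0) (simp add: h_def k d mult_2)
    have "h 0 = a 0 * b (2 * r)" "h r = a (2 * r) * b 0" by (simp_all add: h_def)
    \<comment> \<open>Reflection sends \<open>k\<close> to \<open>Suc d\<close> and
      \<open>Suc k\<close> to \<open>d\<close>, so the four values of \<open>h\<close> form two
      reflected pairs.\<close>
    then show ?thesis using 1 2 refl[of k] refl[of "Suc k"] kr unfolding sub by linarith
  qed
qed

text \<open>Jensen's inequality for a measure of mass at most 1, recovered from Cauchy-Schwarz: the
  ratios \<open>a (2 * k + 2) / a (2 * k)\<close> never fall below \<open>a 2 / a 0\<close>, which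
  is \<open>ratio\<close> with denominators cleared.\<close>

lemma moment_seq_power_le:
  assumes a: "moment_seq a" and a0: "a 0 \<le> 1" and p: "p \<ge> 1"
  shows "\<bar>a 1\<bar> ^ (2 * p) \<le> a (2 * p)"
proof -
  note nn = moment_seq_even_nonneg[OF a]
  have ratio: "a (2 * k) * a 2 \<le> a (2 * Suc k) * a 0" for k
  proof (induction k)
    case (Suc k)
    have cs: "(a (2 * Suc k))\<^sup>2 \<le> a (2 * k) * a (2 * Suc (Suc k))"
      using moment_seq_CS[OF a, of k "Suc (Suc k)"] by (simp add: mult_2)
    show ?case
    proof (cases "a (2 * k) = 0")
      case True
      then have "a (2 * Suc k) = 0" using cs by simp
      then show ?thesis using nn[of "Suc (Suc k)"] nn[of 0] by simp
    next
      case False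
      then have pos: "a (2 * k) > 0" using nn[of k] by simp
      have "a (2 * k) * (a (2 * Suc k) * a 2) \<le> a (2 * Suc k) * (a (2 * Suc k) * a 0)"
        using mult_left_mono[OF Suc.IH nn[of "Suc k"]] by (simp add: mult_ac)
      also have "\<dots> \<le> a (2 * k) * (a (2 * Suc (Suc k)) * a 0)"
        using mult_right_mono[OF cs, of "a 0"] nn[of 0] by (simp add: power2_eq_square mult_ac)
      finally show ?thesis using pos by simp
    qed
  qed simp
  have "a 2 ^ k \<le> a (2 * k)" if "k \<ge> 1" for k
    using that
  proof (induction k rule: nat_induct_at_least)
    case (Suc k)
    have "a 2 ^ Suc k \<le> a (2 * k) * a 2"
      using mult_right_mono[OF Suc.IH, of "a 2"] nn[of 1] by (simp add: mult_ac)
    also have "\<dots> \<le> a (2 * Suc k) * a 0" by (rule ratio)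
    also have "\<dots> \<le> a (2 * Suc k)" using mult_left_mono[OF a0 nn[of "Suc k"]] by simp
    finally show ?case .
  qed simp
  then have "a 2 ^ p \<le> a (2 * p)" using p by simp
  moreover have "(a 1)\<^sup>2 \<le> a 2"
    using moment_seq_CS[OF a, of 0 1] mult_right_mono[OF a0, of "a 2"] nn[of 1] by simp
  then have "((a 1)\<^sup>2) ^ p \<le> a 2 ^ p" by (intro power_mono) auto
  ultimately show ?thesis by (simp add: power_mult)
qed

section \<open>Double factorials and the choice of the moment order\<close>

definition odd_fact :: "nat \<Rightarrow> real"
  where "odd_fact p = (\<Prod>k<p. 2 * real k + 1)"

lemma odd_fact_simps [simp]: "odd_fact 0 = 1" "odd_fact (Suc p) = (2 * real p + 1) * odd_fact p"
  by (simp_all add: odd_fact_def)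

lemma odd_fact_pos: "odd_fact p > 0"
  by (auto simp: odd_fact_def intro!: prod_pos)

text \<open>Twice the bound \<open>artanh x >= x\<close>. At \<open>x = 1 / (2p)\<close> the
  quotient is \<open>(2p+1) / (2p-1)\<close>, which drives the induction for
  \<open>odd_fact_le\<close>.\<close>

lemma ln_quotient_ge:
  fixes x :: real
  assumes "0 \<le> x" "x < 1"
  shows "2 * x \<le> ln ((1 + x) / (1 - x))"
proof -
  let ?f = "\<lambda>x::real. ln (1 + x) - ln (1 - x) - 2 * x"
  have "?f 0 \<le> ?f x"
  proof (rule DERIV_nonneg_imp_nondecreasing[of 0 x ?f])
    fix z :: real assume z: "0 \<le> z" "z \<le> x"
    then have "z\<^sup>2 < 1" using assms by (simp add: abs_square_less_1)
    moreover have "(?f has_real_derivative 1 / (1 + z) + 1 / (1 - z) - 2) (at z)"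
      using z assms by (auto intro!: derivative_eq_intros)
    moreover have "1 / (1 + z) + 1 / (1 - z) - 2 = 2 * z\<^sup>2 / (1 - z\<^sup>2)"
    proof -
      have "1 / (1 + z) + 1 / (1 - z) = ((1 - z) + (1 + z)) / ((1 + z) * (1 - z))"
        using z assms by (simp add: add_frac_eq)
      also have "\<dots> = 2 / (1 - z\<^sup>2)" by (simp add: power2_eq_square algebra_simps)
      finally have "1 / (1 + z) + 1 / (1 - z) - 2 = 2 / w - 2" if "w = 1 - z\<^sup>2" for w
        using that by simp
      moreover have "2 / w - 2 = 2 * (1 - w) / w" if "w \<noteq> 0" for w :: real
        using that by (simp add: field_simps)
      ultimately show ?thesis using \<open>z\<^sup>2 < 1\<close> by force
    qed
    ultimately show "\<exists>y. (?f has_real_derivative y) (at z) \<and> 0 \<le> y"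
      by (metis diff_ge_0_iff_ge divide_nonneg_nonneg less_imp_le mult_nonneg_nonneg zero_le_numeral zero_le_power2)
  qed (use assms in auto)
  then show ?thesis using assms by (simp add: ln_div)
qed

text \<open>A Stirling bound for \<open>(2p-1)!!\<close>, with equality at \<open>p = 1\<close>.
  Passing from \<open>p\<close> to \<open>p + 1\<close> multiplies the right side by
  \<open>(2p+1) * ((2p+1)/(2p-1))^p / e\<close>, and the power is at least \<open>e\<close> by
  \<open>ln_quotient_ge\<close>.\<close>

lemma odd_fact_le:
  assumes "p \<ge> 1"
  shows "odd_fact p \<le> exp 1 * ((2 * real p - 1) / exp 1) ^ p"
  using assms
proof (induction p rule: nat_induct_at_least)
  case base
  then show ?case by simp
next
  case (Suc p)
  define x where "x = 1 / (2 * real p)"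
  have p: "real p \<ge> 1" using Suc by simp
  have x: "0 \<le> x" "x < 1" using p by (auto simp: x_def)
  have q: "(1 + x) / (1 - x) = (2 * real p + 1) / (2 * real p - 1)"
    using p by (simp add: x_def divide_simps)
  have "1 / real p \<le> ln ((2 * real p + 1) / (2 * real p - 1))"
    using ln_quotient_ge[OF x] unfolding q by (simp add: x_def)
  then have "1 \<le> real p * ln ((2 * real p + 1) / (2 * real p - 1))"
    using p by (simp add: field_simps)
  also have "\<dots> = ln (((2 * real p + 1) / (2 * real p - 1)) ^ p)"
    using p by (simp add: ln_realpow)
  finally have "exp 1 \<le> ((2 * real p + 1) / (2 * real p - 1)) ^ p"
    using p by (subst (asm) ln_ge_iff) auto
  then have e: "exp 1 * (2 * real p - 1) ^ p \<le> (2 * real p + 1) ^ p"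
    using p by (simp add: power_divide field_simps)
  have "odd_fact (Suc p) \<le> (2 * real p + 1) * (exp 1 * ((2 * real p - 1) / exp 1) ^ p)"
    using Suc by (simp add: mult_left_mono)
  also have "\<dots> = (2 * real p + 1) * (exp 1 * (2 * real p - 1) ^ p) / exp 1 ^ p"
    by (simp add: power_divide)
  also have "\<dots> \<le> (2 * real p + 1) * (2 * real p + 1) ^ p / exp 1 ^ p"
    using e p by (intro divide_right_mono mult_left_mono) auto
  also have "\<dots> = exp 1 * ((2 * real (Suc p) - 1) / exp 1) ^ Suc p"
    by (simp add: power_divide field_simps)
  finally show ?case .
qed

text \<open>The square in the exponent is the price of an integer \<open>p\<close> away from the
  optimum \<open>y / 16\<close>. The summand \<open>1 / 2\<close> is what remains of the factor
  \<open>exp 1\<close> in \<open>odd_fact_le\<close> after the gain from having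
  \<open>2p - 1\<close> in place of \<open>2p\<close>.\<close>

lemma odd_fact_mult_power_le:
  assumes p: "p \<ge> 1" and y: "y > 0"
  shows "(8 / y) ^ p * odd_fact p \<le> exp (1 / 2 + 16 / y * (real p - y / 16)\<^sup>2 - y / 16)"
proof -
  have p': "real p \<ge> 1" using p by simp
  have "1 - 1 / (2 * real p) \<le> exp (- (1 / (2 * real p)))"
    using exp_ge_add_one_self[of "- (1 / (2 * real p))"] by simp
  then have 1: "2 * real p - 1 \<le> 2 * real p * exp (- (1 / (2 * real p)))"
    using p' by (simp add: field_simps)
  \<comment> \<open>The tangent to \<open>exp\<close> is taken where it is sharp at the optimum
    \<open>p = y / 16\<close>.\<close>
  have 2: "16 * real p / y \<le> exp (16 * real p / y - 1)"
    using exp_ge_add_one_self[of "16 * real p / y - 1"] by simp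
  have "8 / y * ((2 * real p - 1) / exp 1) \<le> 8 / y * ((2 * real p * exp (- (1 / (2 * real p)))) / exp 1)"
    using 1 y by (intro mult_left_mono divide_right_mono) auto
  also have "\<dots> = 16 * real p / y * (exp (- (1 / (2 * real p))) / exp 1)" by simp
  also have "\<dots> \<le> exp (16 * real p / y - 1) * (exp (- (1 / (2 * real p))) / exp 1)"
    using 2 by (intro mult_right_mono) auto
  also have "\<dots> = exp (16 * real p / y - 2 - 1 / (2 * real p))"
    by (simp add: exp_diff[symmetric] exp_add[symmetric])
  finally have "(8 / y * ((2 * real p - 1) / exp 1)) ^ p \<le> exp (16 * real p / y - 2 - 1 / (2 * real p)) ^ p"
    using p' y by (intro power_mono) auto
  also have "\<dots> = exp (real p * (16 * real p / y - 2 - 1 / (2 * real p)))"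
    by (simp add: exp_of_nat_mult)
  also have "real p * (16 * real p / y - 2 - 1 / (2 * real p)) = - (1/2) + 16 / y * (real p - y / 16)\<^sup>2 - y / 16"
    using p' y by (simp add: field_simps power2_eq_square)
  finally have 3: "(8 / y * ((2 * real p - 1) / exp 1)) ^ p \<le> exp (- (1/2) + 16 / y * (real p - y / 16)\<^sup>2 - y / 16)" .
  have "(8 / y) ^ p * odd_fact p \<le> (8 / y) ^ p * (exp 1 * ((2 * real p - 1) / exp 1) ^ p)"
    using odd_fact_le[OF p] y by (intro mult_left_mono) auto
  also have "\<dots> = exp 1 * (8 / y * ((2 * real p - 1) / exp 1)) ^ p"
    by (simp only: power_mult_distrib mult_ac)
  also have "\<dots> \<le> exp 1 * exp (- (1/2) + 16 / y * (real p - y / 16)\<^sup>2 - y / 16)"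
    using 3 by (intro mult_left_mono) auto
  also have "\<dots> = exp (1 / 2 + 16 / y * (real p - y / 16)\<^sup>2 - y / 16)"
    by (simp add: exp_add[symmetric] exp_diff[symmetric])
  finally show ?thesis .
qed

text \<open>A bootstrap: \<open>y\<close> is at least \<open>21 * (3/4 * ln 2 + ln n)\<close>, and
  \<open>n >= y\<close> feeds each lower bound for \<open>y\<close> back into \<open>ln n\<close>.
  Starting from \<open>n >= 1\<close> this gives first 10.5, then 52.5, then more than 56.\<close>

lemma tail_parameter_ge:
  assumes n: "n \<ge> 1" and yn: "y \<le> real n" and big: "2 powr (3/4) * real n \<le> exp (y / 21)"
  shows "y \<ge> 56"
proof -
  have l2: "ln 2 \<ge> (2/3 :: real)" using ln2_ge_two_thirds .
  have lg: "3/4 * ln 2 + ln (real n) \<le> y / 21"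
  proof -
    have "ln (2 powr (3/4) * real n) \<le> ln (exp (y / 21))"
      using big n by (subst ln_le_cancel_iff) auto
    then show ?thesis using n by (simp add: ln_mult ln_powr)
  qed
  have "ln (real n) \<ge> 0" using n by simp
  then have "real n > 10" using lg l2 yn by simp
  then have "ln (2 ^ 3 :: real) < ln (real n)" by (subst ln_less_cancel_iff) auto
  then have "3 * ln 2 < ln (real n)" by (simp only: ln_realpow of_nat_numeral)
  then have "y \<ge> 52" using lg l2 by simp
  then have "real n \<ge> 32" using yn by simp
  then have "ln (2 ^ 5 :: real) \<le> ln (real n)" by (subst ln_le_cancel_iff) auto
  then have "5 * ln 2 \<le> ln (real n)" by (simp only: ln_realpow of_nat_numeral)
  then show ?thesis using lg l2 by simp
qed

text \<open>The integer nearest to \<open>y / 16\<close> serves. The halving on the right leaves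
  room for the factor 2 lost when the self-bounding moment inequality is solved.\<close>

lemma ex_moment_order:
  assumes n: "n \<ge> 1" and yn: "y \<le> real n" and big: "2 powr (3/4) * real n \<le> exp (y / 21)"
  shows "\<exists>p\<ge>1. real n * (8 / y) ^ p * odd_fact p \<le> 2 powr (3/4) * real n * exp (- (y / 21)) / 2"
proof -
  have y: "y \<ge> 56" by (rule tail_parameter_ge[OF assms])
  define p where "p = nat (round (y / 16))"
  have pr: "real p = of_int (round (y / 16))" using round_mono[of 0 "y / 16"] y by (simp add: p_def)
  have d: "\<bar>real p - y / 16\<bar> \<le> 1 / 2"
    unfolding pr using of_int_round_abs_le[of "y / 16"] by simp
  then have p1: "p \<ge> 1" using y by linarith
  have "(real p - y / 16)\<^sup>2 \<le> (1/2)\<^sup>2" using power_mono[OF d, of 2] by simp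
  then have "16 / y * (real p - y / 16)\<^sup>2 \<le> 16 / y * (1/2)\<^sup>2"
    using y by (intro mult_left_mono) auto
  also have "\<dots> \<le> 4 / 56" using y by (simp add: field_simps power2_eq_square)
  finally have sq: "16 / y * (real p - y / 16)\<^sup>2 \<le> 4 / 56" .
  have l2: "ln 2 \<le> (25/36 :: real)" using ln2_le_25_over_36 .
  have "(8 / y) ^ p * odd_fact p \<le> exp (1 / 2 + 16 / y * (real p - y / 16)\<^sup>2 - y / 16)"
    using p1 y by (intro odd_fact_mult_power_le) auto
  \<comment> \<open>The gap \<open>y / 16 - y / 21 = 5 y / 336\<close> is at least
    \<open>5 / 6\<close> for \<open>y >= 56\<close>, which covers
    \<open>1/2 + 4/56 + (ln 2) / 4\<close>. The logarithm is the target factor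
    \<open>2 powr (3/4) / 2\<close>.\<close>
  also have "\<dots> \<le> exp (- (1/4 * ln 2) - y / 21)"
    unfolding exp_le_cancel_iff using sq y l2 by linarith
  also have "\<dots> = 2 powr (3/4) * exp (- (y / 21)) / 2"
  proof -
    have "- (1/4 * ln 2) - y / 21 = 3/4 * ln (2::real) + - (y / 21) - ln 2" by simp
    then show ?thesis by (simp only: exp_add exp_diff) (simp add: powr_def)
  qed
  finally have "real n * ((8 / y) ^ p * odd_fact p) \<le> real n * (2 powr (3/4) * exp (- (y / 21)) / 2)"
    by (intro mult_left_mono) auto
  then show ?thesis using p1 by (intro exI[of _ p]) (simp add: mult_ac)
qed

subsection \<open>Self-adjoint operators on the function space\<close>

context inner_product_function_space
begin

lemma lincomb_mem_ip:
  assumes "finite I" "\<And>i. i \<in> I \<Longrightarrow> y i \<in> H"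
  shows lincomb_mem: "(\<lambda>x. \<Sum>i\<in>I. c i * y i x) \<in> H"
    and ip_lincomb_left: "g \<in> H \<Longrightarrow> ip (\<lambda>x. \<Sum>i\<in>I. c i * y i x) g = (\<Sum>i\<in>I. c i * ip (y i) g)"
proof -
  have "(\<lambda>x. \<Sum>i\<in>I. c i * y i x) \<in> H \<and>
      (g \<in> H \<longrightarrow> ip (\<lambda>x. \<Sum>i\<in>I. c i * y i x) g = (\<Sum>i\<in>I. c i * ip (y i) g))"
    using assms
  proof (induction I rule: finite_induct)
    case empty
    then show ?case using mem_zero ip_zero_left by (simp add: zero_fun_def)
  next
    case (insert i I)
    have eq: "(\<lambda>x. \<Sum>i\<in>insert i I. c i * y i x) = (\<lambda>x. c i * y i x) + (\<lambda>x. \<Sum>i\<in>I. c i * y i x)"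
      using insert.hyps by (simp add: fun_eq_iff)
    have "(\<lambda>x. c i * y i x) \<in> H" using insert.prems by (intro mem_scale) auto
    then show ?case
      unfolding eq using insert by (auto simp: ip_add ip_scale intro: mem_add)
  qed
  then show "(\<lambda>x. \<Sum>i\<in>I. c i * y i x) \<in> H"
    "g \<in> H \<Longrightarrow> ip (\<lambda>x. \<Sum>i\<in>I. c i * y i x) g = (\<Sum>i\<in>I. c i * ip (y i) g)" by auto
qed

lemma cmod_ip_commute: "f \<in> H \<Longrightarrow> g \<in> H \<Longrightarrow> cmod (ip f g) = cmod (ip g f)"
  using ip_cnj by (metis complex_mod_cnj)

lemma Cauchy_Schwarz_sq:
  assumes "f \<in> H" "g \<in> H"
  shows "(cmod (ip f g))\<^sup>2 \<le> Re (ip f f) * Re (ip g g)"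
  using power_mono[OF Cauchy_Schwarz[OF assms], of 2] ip_nonneg assms
  by (simp add: ip_norm_def power_mult_distrib)

lemma unit_ball_iff: "f \<in> unit_ball H ip \<longleftrightarrow> f \<in> H \<and> Re (ip f f) \<le> 1"
  by (auto simp: unit_ball_def ip_norm_def)

definition selfadjoint :: "(('a \<Rightarrow> complex) \<Rightarrow> 'a \<Rightarrow> complex) \<Rightarrow> bool"
  where "selfadjoint A \<longleftrightarrow> (\<forall>f\<in>H. A f \<in> H) \<and> (\<forall>f\<in>H. \<forall>g\<in>H. ip (A f) g = ip f (A g))"

lemma selfadjoint_power_mem: "selfadjoint A \<Longrightarrow> f \<in> H \<Longrightarrow> (A ^^ m) f \<in> H"
  by (induction m) (auto simp: selfadjoint_def)

lemma selfadjoint_power: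
  assumes "selfadjoint A" "f \<in> H" "g \<in> H"
  shows "ip ((A ^^ m) f) g = ip f ((A ^^ m) g)"
  using assms(3)
proof (induction m arbitrary: g)
  case (Suc m)
  have "ip ((A ^^ Suc m) f) g = ip ((A ^^ m) f) (A g)"
    using assms(1,2) Suc.prems selfadjoint_power_mem[OF assms(1,2)] by (simp add: selfadjoint_def)
  also have "\<dots> = ip f ((A ^^ m) (A g))"
    using assms(1) Suc.prems by (intro Suc.IH) (auto simp: selfadjoint_def)
  finally show ?case by (simp add: funpow_swap1)
qed simp

lemma selfadjoint_power_add:
  assumes "selfadjoint A" "f \<in> H"
  shows "ip ((A ^^ (j + k)) f) f = ip ((A ^^ j) f) ((A ^^ k) f)"
  using selfadjoint_power[OF assms(1) selfadjoint_power_mem[OF assms, of j] assms(2), of k]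
  by (simp add: funpow_add[symmetric] add.commute flip: comp_apply[of "A ^^ k" "A ^^ j"])

lemma selfadjoint_moment_real:
  assumes "selfadjoint A" "f \<in> H"
  shows "ip ((A ^^ m) f) f = of_real (Re (ip ((A ^^ m) f) f))"
  using selfadjoint_power[OF assms assms(2), of m]
    ip_cnj[OF selfadjoint_power_mem[OF assms, of m] assms(2)]
  by (simp add: complex_eq_iff)

text \<open>Splitting \<open>A^(j+k)\<close> across the inner product reduces both conditions to
  positivity and Cauchy-Schwarz for the vectors \<open>A^j f\<close> and
  \<open>A^k f\<close>.\<close>

lemma selfadjoint_moment_seq:
  assumes "selfadjoint A" "f \<in> H"
  shows "moment_seq (\<lambda>m. Re (ip ((A ^^ m) f) f))"
proof -
  note mem = selfadjoint_power_mem[OF assms]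
  have even: "Re (ip ((A ^^ (2 * j)) f) f) = Re (ip ((A ^^ j) f) ((A ^^ j) f))" for j
    using selfadjoint_power_add[OF assms, of j j] by (simp add: mult_2)
  have "(Re (ip ((A ^^ (j + k)) f) f))\<^sup>2 \<le> (cmod (ip ((A ^^ j) f) ((A ^^ k) f)))\<^sup>2" for j k
    unfolding selfadjoint_power_add[OF assms]
    using abs_Re_le_cmod by (simp add: abs_le_square_iff[symmetric])
  then show ?thesis
    unfolding moment_seq_def even
    using Cauchy_Schwarz_sq[OF mem mem] ip_nonneg[OF mem] order_trans by blast
qed

text \<open>Telescoping of \<open>A^m - B^m\<close> into the terms
  \<open>A^q (A - B) B^(m-1-q)\<close>, with \<open>A^q\<close> moved to \<open>g\<close>. As
  \<open>A - B\<close> is \<open>c\<close> times the rank-one operator of \<open>y\<close>, each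
  term becomes a product of two scalars.\<close>

lemma ip_power_diff:
  assumes A: "selfadjoint A" and B: "selfadjoint B" and y: "y \<in> H"
    and diff: "\<And>f g. f \<in> H \<Longrightarrow> g \<in> H \<Longrightarrow> ip (A f) g - ip (B f) g = c * ip f y * ip y g"
    and f: "f \<in> H" and g: "g \<in> H"
  shows "ip ((A ^^ m) f) g - ip ((B ^^ m) f) g
    = (\<Sum>q<m. c * ip ((B ^^ (m - Suc q)) f) y * ip y ((A ^^ q) g))"
  using g
proof (induction m arbitrary: g)
  case (Suc m)
  note Am = selfadjoint_power_mem[OF A f, of m] and Bm = selfadjoint_power_mem[OF B f, of m]
  have Ag: "A g \<in> H" using A Suc.prems by (simp add: selfadjoint_def)
  have "ip ((A ^^ Suc m) f) g - ip ((B ^^ Suc m) f) g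
      = (ip ((A ^^ m) f) (A g) - ip ((B ^^ m) f) (A g))
        + (ip (A ((B ^^ m) f)) g - ip (B ((B ^^ m) f)) g)"
    using A Am Bm Suc.prems by (simp add: selfadjoint_def)
  also have "\<dots> = (\<Sum>q<m. c * ip ((B ^^ (m - Suc q)) f) y * ip y ((A ^^ q) (A g)))
        + c * ip ((B ^^ m) f) y * ip y g"
    using Suc.IH[OF Ag] diff[OF Bm Suc.prems] by simp
  also have "\<dots> = (\<Sum>q<Suc m. c * ip ((B ^^ (Suc m - Suc q)) f) y * ip y ((A ^^ q) g))"
    by (subst sum.lessThan_Suc_shift) (simp add: funpow_swap1)
  finally show ?case .
qed simp

text \<open>Gram-Schmidt in weak form: the expansion is tested against vectors \<open>g\<close>,
  which is how the trace computations consume it. The cardinality bound becomes the factor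
  \<open>n\<close> of the tail estimate.\<close>

lemma orthonormal_expansion_exists:
  assumes "finite I" "\<And>i. i \<in> I \<Longrightarrow> y i \<in> H"
  shows "\<exists>E. finite E \<and> card E \<le> card I \<and> E \<subseteq> H \<and>
    (\<forall>e\<in>E. \<forall>e'\<in>E. ip e e' = (if e = e' then 1 else 0)) \<and>
    (\<forall>i\<in>I. \<forall>g\<in>H. ip (y i) g = (\<Sum>e\<in>E. ip (y i) e * ip e g))"
  using assms
proof (induction I rule: finite_induct)
  case empty
  show ?case by (intro exI[of _ "{}"]) auto
next
  case (insert i I)
  then obtain E where fin: "finite E" and card: "card E \<le> card I" and E: "E \<subseteq> H"
    and on: "\<And>e e'. e \<in> E \<Longrightarrow> e' \<in> E \<Longrightarrow> ip e e' = (if e = e' then 1 else 0)"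
    and ex: "\<And>j g. j \<in> I \<Longrightarrow> g \<in> H \<Longrightarrow> ip (y j) g = (\<Sum>e\<in>E. ip (y j) e * ip e g)"
    by auto
  have yi: "y i \<in> H" using insert.prems by simp
  define v where "v = (\<lambda>x. \<Sum>e\<in>E. ip (y i) e * e x)"
  define u where "u = y i - v"
  have vH: "v \<in> H" unfolding v_def using fin E by (intro lincomb_mem) auto
  have ipv: "ip v g = (\<Sum>e\<in>E. ip (y i) e * ip e g)" if "g \<in> H" for g
    unfolding v_def using fin E that by (subst ip_lincomb_left) auto
  have uH: "u \<in> H" unfolding u_def by (rule mem_diff[OF yi vH])
  have yu: "ip (y i) g = ip u g + ip v g" if "g \<in> H" for g
    using ip_add[OF uH vH that] by (simp add: u_def)
  have ue: "ip u e = 0" if "e \<in> E" for e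
  proof -
    have "ip v e = (\<Sum>e'\<in>E. ip (y i) e' * (if e' = e then 1 else 0))"
      using that E on by (subst ipv) (auto intro!: sum.cong)
    also have "\<dots> = ip (y i) e" using that fin by (simp add: if_distrib sum.delta cong: if_cong)
    finally show ?thesis using yu[of e] that E by auto
  qed
  show ?case
  \<comment> \<open>A zero residual means that \<open>y i\<close> already expands over
    \<open>E\<close>; otherwise the normalised residual is the one new vector.\<close>
  proof (cases "ip u u = 0")
    case True
    then have "u = 0" by (rule ip_definite[OF uH])
    then have "ip (y i) g = (\<Sum>e\<in>E. ip (y i) e * ip e g)" if "g \<in> H" for g
      using yu[OF that] ipv[OF that] ip_zero_left[OF that] by simp
    then show ?thesis using fin card E on ex insert.hyps
      by (intro exI[of _ E]) (auto simp: le_SucI)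
  next
    case False
    define r where "r = ip_norm ip u"
    have uu: "ip u u = of_real (r\<^sup>2)" 
      using ip_self[OF uH] ip_nonneg[OF uH] by (simp add: r_def ip_norm_def)
    have r: "r \<noteq> 0" using False uu by auto
    define e0 where "e0 = (\<lambda>x. of_real (1 / r) * u x)"
    have e0H: "e0 \<in> H" unfolding e0_def by (rule mem_scale[OF uH])
    have e0l: "ip e0 g = of_real (1 / r) * ip u g" if "g \<in> H" for g
      unfolding e0_def by (rule ip_scale[OF uH that])
    have ue0: "ip u e0 = of_real r"
      unfolding e0_def using r by (subst ip_scale_right[OF uH uH]) (simp add: uu power2_eq_square)
    have e0e0: "ip e0 e0 = 1" using e0l[OF e0H] ue0 r by simp
    have e0E: "ip e0 e = 0" "ip e e0 = 0" if "e \<in> E" for e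
      using e0l[of e] ue[OF that] ip_cnj[of e e0] that E e0H by auto
    have notin: "e0 \<notin> E" using e0E e0e0 by force
    have sumE: "(\<Sum>e\<in>E. c e * ip e e0) = 0" for c using e0E by simp
    have new: "ip (y i) g = (\<Sum>e\<in>insert e0 E. ip (y i) e * ip e g)" if "g \<in> H" for g
    proof -
      have "ip (y i) e0 = of_real r"
        using yu[OF e0H] ipv[OF e0H] sumE ue0 by simp
      then show ?thesis
        using yu[OF that] ipv[OF that] e0l[OF that] notin fin r by simp
    qed
    have old: "ip (y j) g = (\<Sum>e\<in>insert e0 E. ip (y j) e * ip e g)" if "j \<in> I" "g \<in> H" for j g
      using ex[OF that] ex[OF that(1) e0H] sumE notin fin by simp
    have "card (insert e0 E) \<le> card (insert i I)" using fin card notin insert.hyps by simp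
    moreover have "\<forall>e\<in>insert e0 E. \<forall>e'\<in>insert e0 E. ip e e' = (if e = e' then 1 else 0)"
      using on e0e0 e0E notin by auto
    moreover have "\<forall>j\<in>insert i I. \<forall>g\<in>H. ip (y j) g = (\<Sum>e\<in>insert e0 E. ip (y j) e * ip e g)"
      using new old by blast
    ultimately show ?thesis
      using fin E e0H by (intro exI[of _ "insert e0 E"]) blast
  qed
qed

end

subsection \<open>A Khintchine inequality for rank-one operators\<close>

text \<open>Rademacher averages appear as unnormalised sums over this set, so powers of 2 accompany
  them throughout. Extensionality keeps the set finite for finite \<open>I\<close>.\<close>

abbreviation sign_vectors :: "'i set \<Rightarrow> ('i \<Rightarrow> real) set"
  where "sign_vectors I \<equiv> I \<rightarrow>\<^sub>E {- 1, 1}"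

lemma card_sign_vectors: "finite I \<Longrightarrow> card (sign_vectors I) = 2 ^ card I"
  by (simp add: card_PiE numeral_2_eq_2)

lemma sign_vectorsD: "\<epsilon> \<in> sign_vectors I \<Longrightarrow> i \<in> I \<Longrightarrow> \<epsilon> i = -1 \<or> \<epsilon> i = 1"
  by (auto dest: PiE_mem)

definition flip :: "'i \<Rightarrow> ('i \<Rightarrow> real) \<Rightarrow> 'i \<Rightarrow> real"
  where "flip i \<epsilon> = \<epsilon>(i := - \<epsilon> i)"

lemma flip_mem: "i \<in> I \<Longrightarrow> \<epsilon> \<in> sign_vectors I \<Longrightarrow> flip i \<epsilon> \<in> sign_vectors I"
  by (auto simp: flip_def PiE_iff extensional_def)

lemma flip_apply: "flip i \<epsilon> i = - \<epsilon> i"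
  by (simp add: flip_def)

lemma flip_flip: "flip i (flip i \<epsilon>) = \<epsilon>"
  by (simp add: flip_def)

lemma sum_sign_vectors_flip:
  "i \<in> I \<Longrightarrow> (\<Sum>\<epsilon>\<in>sign_vectors I. \<phi> (flip i \<epsilon>)) = (\<Sum>\<epsilon>\<in>sign_vectors I. \<phi> \<epsilon>)"
  by (rule sum.reindex_bij_witness[where i = "flip i" and j = "flip i"])
    (simp_all only: flip_mem flip_flip)

locale vector_family = inner_product_function_space D H ip
  for D :: "'a set" and H :: "('a \<Rightarrow> complex) set"
    and ip :: "('a \<Rightarrow> complex) \<Rightarrow> ('a \<Rightarrow> complex) \<Rightarrow> complex" +
  fixes I :: "'i set" and y :: "'i \<Rightarrow> 'a \<Rightarrow> complex" and E :: "('a \<Rightarrow> complex) set"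
  assumes finite_I: "finite I" and y_mem: "i \<in> I \<Longrightarrow> y i \<in> H"
    and finite_E: "finite E" and E_mem: "e \<in> E \<Longrightarrow> e \<in> H" and E_unit: "e \<in> E \<Longrightarrow> ip e e = 1"
    and expansion: "i \<in> I \<Longrightarrow> g \<in> H \<Longrightarrow> ip (y i) g = (\<Sum>e\<in>E. ip (y i) e * ip e g)"
begin

text \<open>\<open>E\<close> is an orthonormal system spanning all \<open>y i\<close>, and \<open>tr\<close> below is the trace over \<open>E\<close>.
  Orthogonality enters only through the expansion.\<close>

definition signed_op :: "('i \<Rightarrow> real) \<Rightarrow> ('a \<Rightarrow> complex) \<Rightarrow> 'a \<Rightarrow> complex"
  where "signed_op \<epsilon> f = (\<lambda>x. \<Sum>i\<in>I. (of_real (\<epsilon> i) * ip f (y i)) * y i x)"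

lemma signed_op_mem: "signed_op \<epsilon> f \<in> H"
  unfolding signed_op_def by (intro lincomb_mem finite_I y_mem)

lemma ip_signed_op:
  "g \<in> H \<Longrightarrow> ip (signed_op \<epsilon> f) g = (\<Sum>i\<in>I. of_real (\<epsilon> i) * ip f (y i) * ip (y i) g)"
  unfolding signed_op_def by (subst ip_lincomb_left) (auto intro: finite_I y_mem)

lemma selfadjoint_signed_op: "selfadjoint (signed_op \<epsilon>)"
  unfolding selfadjoint_def
proof (intro conjI ballI)
  fix f g assume f: "f \<in> H" and g: "g \<in> H"
  have "ip f (signed_op \<epsilon> g) = cnj (ip (signed_op \<epsilon> g) f)"
    by (rule ip_cnj[OF f signed_op_mem])
  also have "\<dots> = (\<Sum>i\<in>I. of_real (\<epsilon> i) * cnj (ip g (y i)) * cnj (ip (y i) f))"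
    by (simp add: ip_signed_op[OF f])
  also have "\<dots> = (\<Sum>i\<in>I. of_real (\<epsilon> i) * ip f (y i) * ip (y i) g)"
    using f g by (intro sum.cong refl) (simp only: ip_cnj[OF f y_mem] ip_cnj[OF y_mem g] mult_ac)
  finally show "ip (signed_op \<epsilon> f) g = ip f (signed_op \<epsilon> g)" by (simp add: ip_signed_op[OF g])
qed (rule signed_op_mem)

abbreviation pow :: "('i \<Rightarrow> real) \<Rightarrow> nat \<Rightarrow> ('a \<Rightarrow> complex) \<Rightarrow> 'a \<Rightarrow> complex"
  where "pow \<epsilon> m \<equiv> signed_op \<epsilon> ^^ m"

lemmas pow_mem = selfadjoint_power_mem[OF selfadjoint_signed_op]
  and pow_selfadjoint = selfadjoint_power[OF selfadjoint_signed_op]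
  and pow_add = selfadjoint_power_add[OF selfadjoint_signed_op]
  and pow_moment_seq = selfadjoint_moment_seq[OF selfadjoint_signed_op]

definition tr :: "('i \<Rightarrow> real) \<Rightarrow> nat \<Rightarrow> real"
  where "tr \<epsilon> m = (\<Sum>e\<in>E. Re (ip (pow \<epsilon> m e) e))"

lemma tr_0: "tr \<epsilon> 0 = real (card E)"
  by (simp add: tr_def E_unit)

lemma pow_double: "f \<in> H \<Longrightarrow> Re (ip (pow \<epsilon> (2 * k) f) f) = Re (ip (pow \<epsilon> k f) (pow \<epsilon> k f))"
  using pow_add[of f k k] by (simp add: mult_2)

lemma tr_even: "tr \<epsilon> (2 * k) = (\<Sum>e\<in>E. Re (ip (pow \<epsilon> k e) (pow \<epsilon> k e)))"
  unfolding tr_def by (intro sum.cong refl pow_double E_mem)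

text \<open>One application of \<open>signed_op\<close> lands in the span of the vectors
  \<open>y i\<close>, where the expansion over \<open>E\<close> is available; without an application
  the vector itself must be some \<open>y i\<close>.\<close>

lemma expansion_pow:
  assumes "k \<ge> 1 \<or> v \<in> y ` I" "g \<in> H"
  shows "ip (pow \<epsilon> k v) g = (\<Sum>e\<in>E. ip (pow \<epsilon> k v) e * ip e g)"
proof (cases k)
  case 0
  then show ?thesis using assms expansion by auto
next
  case (Suc m)
  let ?w = "pow \<epsilon> m v"
  have "ip (signed_op \<epsilon> ?w) g = (\<Sum>i\<in>I. of_real (\<epsilon> i) * ip ?w (y i) * (\<Sum>e\<in>E. ip (y i) e * ip e g))"
    using assms by (simp add: ip_signed_op expansion)
  also have "\<dots> = (\<Sum>e\<in>E. \<Sum>i\<in>I. of_real (\<epsilon> i) * ip ?w (y i) * (ip (y i) e * ip e g))"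
    unfolding sum_distrib_left by (rule sum.swap)
  also have "\<dots> = (\<Sum>e\<in>E. ip (signed_op \<epsilon> ?w) e * ip e g)"
    by (intro sum.cong refl) (simp add: ip_signed_op E_mem sum_distrib_right sum_distrib_left mult_ac)
  finally show ?thesis by (simp add: Suc)
qed

text \<open>Parseval over \<open>E\<close> for \<open>pow \<epsilon> k v\<close>, after which
  self-adjointness moves the power onto the basis vectors.\<close>

lemma norm_pow:
  assumes "k \<ge> 1 \<or> v \<in> y ` I" "v \<in> H"
  shows "Re (ip (pow \<epsilon> k v) (pow \<epsilon> k v)) = (\<Sum>e\<in>E. (cmod (ip v (pow \<epsilon> k e)))\<^sup>2)"
proof -
  let ?w = "pow \<epsilon> k v"
  have w: "?w \<in> H" by (rule pow_mem[OF assms(2)])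
  have "ip ?w ?w = (\<Sum>e\<in>E. ip ?w e * ip e ?w)"
    by (rule expansion_pow[OF assms(1) w])
  also have "\<dots> = (\<Sum>e\<in>E. of_real ((cmod (ip ?w e))\<^sup>2))"
  proof (intro sum.cong refl)
    fix e assume "e \<in> E"
    then have "ip e ?w = cnj (ip ?w e)" by (intro ip_cnj E_mem w)
    then show "ip ?w e * ip e ?w = of_real ((cmod (ip ?w e))\<^sup>2)"
      by (metis complex_norm_square)
  qed
  finally have "Re (ip ?w ?w) = (\<Sum>e\<in>E. (cmod (ip ?w e))\<^sup>2)" by simp
  then show ?thesis using assms(2) E_mem by (simp add: pow_selfadjoint)
qed

text \<open>The operator norm of the \<open>k\<close>-th power is at most its Hilbert-Schmidt norm,
  whose square is \<open>tr \<epsilon> (2 * k)\<close>.\<close>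

lemma norm_pow_le_tr:
  assumes "k \<ge> 1" "f \<in> H"
  shows "Re (ip (pow \<epsilon> k f) (pow \<epsilon> k f)) \<le> Re (ip f f) * tr \<epsilon> (2 * k)"
proof -
  have "(\<Sum>e\<in>E. (cmod (ip f (pow \<epsilon> k e)))\<^sup>2) \<le> Re (ip f f) * tr \<epsilon> (2 * k)"
    unfolding tr_even sum_distrib_left using assms
    by (intro sum_mono Cauchy_Schwarz_sq pow_mem) (auto intro: E_mem)
  then show ?thesis using assms by (simp add: norm_pow)
qed

text \<open>The passage from a supremum over the unit ball to a trace: Jensen for the moments at
  \<open>f\<close> raises the form to the power \<open>2 * p\<close>, and the trace then dominates
  uniformly in \<open>f\<close>.\<close>

lemma quadratic_form_le_tr:
  assumes "p \<ge> 1" "f \<in> unit_ball H ip"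
  shows "\<bar>\<Sum>i\<in>I. \<epsilon> i * (cmod (ip f (y i)))\<^sup>2\<bar> ^ (2 * p) \<le> tr \<epsilon> (2 * p)"
proof -
  have f: "f \<in> H" and f1: "Re (ip f f) \<le> 1" using assms(2) by (auto simp: unit_ball_iff)
  have "ip (signed_op \<epsilon> f) f = (\<Sum>i\<in>I. of_real (\<epsilon> i * (cmod (ip f (y i)))\<^sup>2))"
    unfolding ip_signed_op[OF f]
  proof (intro sum.cong refl)
    fix i assume "i \<in> I"
    then have "ip (y i) f = cnj (ip f (y i))" by (intro ip_cnj y_mem f)
    then show "of_real (\<epsilon> i) * ip f (y i) * ip (y i) f = of_real (\<epsilon> i * (cmod (ip f (y i)))\<^sup>2)"
      by (simp only: of_real_mult complex_norm_square mult.assoc)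
  qed
  then have "(\<Sum>i\<in>I. \<epsilon> i * (cmod (ip f (y i)))\<^sup>2) = Re (ip (pow \<epsilon> 1 f) f)" by simp
  then have "\<bar>\<Sum>i\<in>I. \<epsilon> i * (cmod (ip f (y i)))\<^sup>2\<bar> ^ (2 * p) \<le> Re (ip (pow \<epsilon> (2 * p) f) f)"
    using moment_seq_power_le[OF pow_moment_seq[OF f, of \<epsilon>] _ assms(1)] f1 by simp
  also have "\<dots> = Re (ip (pow \<epsilon> p f) (pow \<epsilon> p f))" by (rule pow_double[OF f])
  also have "\<dots> \<le> Re (ip f f) * tr \<epsilon> (2 * p)" by (rule norm_pow_le_tr[OF assms(1) f])
  also have "\<dots> \<le> 1 * tr \<epsilon> (2 * p)"
    unfolding tr_even using f1 E_mem by (intro mult_right_mono sum_nonneg ip_nonneg pow_mem) auto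
  finally show ?thesis by simp
qed

text \<open>With \<open>A = signed_op \<epsilon>\<close> and \<open>S\<close> the sum of the
  rank-one operators of the \<open>y i\<close>, the left side is the trace of
  \<open>A^k S A^k\<close>, and the hypothesis says that \<open>S\<close> is at most
  \<open>s\<close> times the identity.\<close>

lemma sum_moments_le_tr:
  assumes s: "\<And>f. f \<in> H \<Longrightarrow> (\<Sum>i\<in>I. (cmod (ip f (y i)))\<^sup>2) \<le> s * Re (ip f f)"
  shows "(\<Sum>i\<in>I. Re (ip (pow \<epsilon> (2 * k) (y i)) (y i))) \<le> s * tr \<epsilon> (2 * k)"
proof -
  have "(\<Sum>i\<in>I. Re (ip (pow \<epsilon> (2 * k) (y i)) (y i)))
      = (\<Sum>i\<in>I. \<Sum>e\<in>E. (cmod (ip (y i) (pow \<epsilon> k e)))\<^sup>2)"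
    by (intro sum.cong refl) (simp add: pow_double y_mem norm_pow)
  also have "\<dots> = (\<Sum>e\<in>E. \<Sum>i\<in>I. (cmod (ip (pow \<epsilon> k e) (y i)))\<^sup>2)"
    by (subst sum.swap) (intro sum.cong refl, simp add: cmod_ip_commute y_mem pow_mem E_mem)
  also have "\<dots> \<le> (\<Sum>e\<in>E. s * Re (ip (pow \<epsilon> k e) (pow \<epsilon> k e)))"
    by (intro sum_mono s pow_mem E_mem)
  finally show ?thesis by (simp add: tr_even sum_distrib_left)
qed

text \<open>One factor \<open>A\<close> is written out as its signed sum and the expansion over
  \<open>E\<close> collapses the trace. This exposes a single explicit sign
  \<open>\<epsilon> i\<close>, over which one can average.\<close>

lemma tr_Suc: "tr \<epsilon> (Suc m) = (\<Sum>i\<in>I. \<epsilon> i * Re (ip (pow \<epsilon> m (y i)) (y i)))"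
proof -
  have "(\<Sum>e\<in>E. ip (pow \<epsilon> (Suc m) e) e)
      = (\<Sum>e\<in>E. \<Sum>i\<in>I. of_real (\<epsilon> i) * (ip (y i) e * ip e (pow \<epsilon> m (y i))))"
    by (intro sum.cong refl)
      (simp add: ip_signed_op E_mem pow_selfadjoint y_mem mult_ac)
  also have "\<dots> = (\<Sum>i\<in>I. of_real (\<epsilon> i) * (\<Sum>e\<in>E. ip (y i) e * ip e (pow \<epsilon> m (y i))))"
    unfolding sum_distrib_left by (rule sum.swap)
  also have "\<dots> = (\<Sum>i\<in>I. of_real (\<epsilon> i) * ip (pow \<epsilon> m (y i)) (y i))"
    by (intro sum.cong refl)
      (simp add: expansion[symmetric] y_mem pow_mem pow_selfadjoint)
  finally have "Re (\<Sum>e\<in>E. ip (pow \<epsilon> (Suc m) e) e)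
      = Re (\<Sum>i\<in>I. of_real (\<epsilon> i) * ip (pow \<epsilon> m (y i)) (y i))" by simp
  then show ?thesis by (simp add: tr_def)
qed

lemma signed_op_flip_diff:
  assumes i: "i \<in> I" and g: "g \<in> H"
  shows "ip (signed_op \<epsilon> f) g - ip (signed_op (flip i \<epsilon>) f) g
    = of_real (2 * \<epsilon> i) * ip f (y i) * ip (y i) g"
proof -
  have "ip (signed_op \<epsilon> f) g - ip (signed_op (flip i \<epsilon>) f) g
      = (\<Sum>j\<in>I. if j = i then of_real (2 * \<epsilon> i) * ip f (y i) * ip (y i) g else 0)"
    unfolding ip_signed_op[OF g] sum_subtractf[symmetric]
    by (intro sum.cong refl) (auto simp: flip_def)
  then show ?thesis using i finite_I by (simp add: sum.delta)
qed

text \<open>Flipping the sign of \<open>i\<close> perturbs the operator exactly in the direction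
  \<open>y i\<close>, so \<open>ip_power_diff\<close> taken at \<open>y i\<close> itself returns
  only moments at that same vector.\<close>

lemma moment_flip_diff:
  assumes i: "i \<in> I"
  shows "Re (ip (pow \<epsilon> m (y i)) (y i)) - Re (ip (pow (flip i \<epsilon>) m (y i)) (y i))
    = 2 * \<epsilon> i * (\<Sum>q<m. Re (ip (pow \<epsilon> q (y i)) (y i))
        * Re (ip (pow (flip i \<epsilon>) (m - Suc q) (y i)) (y i)))"
proof -
  note yi = y_mem[OF i]
  note re = selfadjoint_moment_real[OF selfadjoint_signed_op yi]
  have "ip (pow \<epsilon> m (y i)) (y i) - ip (pow (flip i \<epsilon>) m (y i)) (y i)
     = (\<Sum>q<m. of_real (2 * \<epsilon> i) * ip (pow (flip i \<epsilon>) (m - Suc q) (y i)) (y i) * ip (y i) (pow \<epsilon> q (y i)))"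
    by (rule ip_power_diff[OF selfadjoint_signed_op selfadjoint_signed_op yi signed_op_flip_diff[OF i] yi yi])
  also have "\<dots> = (\<Sum>q<m. of_real (2 * \<epsilon> i * (Re (ip (pow \<epsilon> q (y i)) (y i))
        * Re (ip (pow (flip i \<epsilon>) (m - Suc q) (y i)) (y i)))))"
  proof (intro sum.cong refl)
    fix q
    show "of_real (2 * \<epsilon> i) * ip (pow (flip i \<epsilon>) (m - Suc q) (y i)) (y i) * ip (y i) (pow \<epsilon> q (y i))
      = complex_of_real (2 * \<epsilon> i * (Re (ip (pow \<epsilon> q (y i)) (y i))
        * Re (ip (pow (flip i \<epsilon>) (m - Suc q) (y i)) (y i))))"
      unfolding pow_selfadjoint[OF yi yi, symmetric]
      by (subst (1) re, subst (2) re) simp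
  qed
  finally have "Re (ip (pow \<epsilon> m (y i)) (y i) - ip (pow (flip i \<epsilon>) m (y i)) (y i))
    = Re (\<Sum>q<m. of_real (2 * \<epsilon> i * (Re (ip (pow \<epsilon> q (y i)) (y i))
        * Re (ip (pow (flip i \<epsilon>) (m - Suc q) (y i)) (y i)))))" by simp
  then show ?thesis by (simp only: Re_sum Re_complex_of_real minus_complex.sel sum_distrib_left)
qed

text \<open>Averaging over the sign \<open>\<epsilon> i\<close> replaces the moment by half its difference under a sign flip,
  which telescopes into products of moments of the two operators.\<close>

lemma sum_signed_moments_le:
  assumes i: "i \<in> I" and M: "Re (ip (y i) (y i)) \<le> M2"
  shows "(\<Sum>\<epsilon>\<in>sign_vectors I. \<epsilon> i * Re (ip (pow \<epsilon> (2 * p + 1) (y i)) (y i)))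
    \<le> (2 * real p + 1) * M2 * (\<Sum>\<epsilon>\<in>sign_vectors I. Re (ip (pow \<epsilon> (2 * p) (y i)) (y i)))"
proof -
  let ?S = "sign_vectors I"
  define a where "a \<epsilon> m = Re (ip (pow \<epsilon> m (y i)) (y i))" for \<epsilon> m
  have ms: "moment_seq (a \<epsilon>)" for \<epsilon>
    unfolding a_def by (rule pow_moment_seq[OF y_mem[OF i]])
  have a0: "a \<epsilon> 0 \<le> M2" for \<epsilon> using M by (simp add: a_def)
  have pair: "2 * (\<Sum>q<2 * p + 1. a \<epsilon> q * a \<delta> (2 * p - q)) \<le> (2 * real p + 1) * M2 * (a \<epsilon> (2 * p) + a \<delta> (2 * p))"
    for \<epsilon> \<delta>
  proof -
    \<comment> \<open>Averaging the sum with its reflection \<open>q\<close> to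
      \<open>2 * p - q\<close> creates the symmetric pairs that \<open>moment_seq_cross_le\<close>
      bounds.\<close>
    have "(\<Sum>q<2 * p + 1. a \<epsilon> q * a \<delta> (2 * p - q)) = (\<Sum>q<2 * p + 1. a \<epsilon> (2 * p - q) * a \<delta> q)"
      by (rule sum.reindex_bij_witness[where i = "\<lambda>q. 2 * p - q" and j = "\<lambda>q. 2 * p - q"]) auto
    then have "2 * (\<Sum>q<2 * p + 1. a \<epsilon> q * a \<delta> (2 * p - q))
        = (\<Sum>q<2 * p + 1. a \<epsilon> q * a \<delta> (2 * p - q) + a \<epsilon> (2 * p - q) * a \<delta> q)"
      unfolding sum.distrib by linarith
    also have "\<dots> \<le> (\<Sum>q<2 * p + 1. M2 * (a \<epsilon> (2 * p) + a \<delta> (2 * p)))"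
    proof (intro sum_mono)
      fix q assume "q \<in> {..<2 * p + 1}"
      then have "\<bar>a \<epsilon> q * a \<delta> (2 * p - q)\<bar> + \<bar>a \<epsilon> (2 * p - q) * a \<delta> q\<bar>
          \<le> a \<epsilon> 0 * a \<delta> (2 * p) + a \<epsilon> (2 * p) * a \<delta> 0"
        by (intro moment_seq_cross_le ms) auto
      also have "\<dots> \<le> M2 * a \<delta> (2 * p) + a \<epsilon> (2 * p) * M2"
        using a0 moment_seq_even_nonneg[OF ms] by (intro add_mono mult_right_mono mult_left_mono) auto
      finally show "a \<epsilon> q * a \<delta> (2 * p - q) + a \<epsilon> (2 * p - q) * a \<delta> q \<le> M2 * (a \<epsilon> (2 * p) + a \<delta> (2 * p))"
        by (simp add: algebra_simps)
    qed
    also have "\<dots> = (2 * real p + 1) * M2 * (a \<epsilon> (2 * p) + a \<delta> (2 * p))" by simp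
    finally show ?thesis .
  qed
  have "2 * (\<Sum>\<epsilon>\<in>?S. \<epsilon> i * a \<epsilon> (2 * p + 1))
      = (\<Sum>\<epsilon>\<in>?S. \<epsilon> i * a \<epsilon> (2 * p + 1)) + (\<Sum>\<epsilon>\<in>?S. flip i \<epsilon> i * a (flip i \<epsilon>) (2 * p + 1))"
    using sum_sign_vectors_flip[OF i, of "\<lambda>\<epsilon>. \<epsilon> i * a \<epsilon> (2 * p + 1)"] by simp
  also have "\<dots> = (\<Sum>\<epsilon>\<in>?S. \<epsilon> i * (a \<epsilon> (2 * p + 1) - a (flip i \<epsilon>) (2 * p + 1)))"
    unfolding sum.distrib[symmetric]
    by (intro sum.cong refl) (simp only: flip_apply right_diff_distrib minus_mult_left[symmetric] add_uminus_conv_diff)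
  also have "\<dots> = (\<Sum>\<epsilon>\<in>?S. 2 * (\<Sum>q<2 * p + 1. a \<epsilon> q * a (flip i \<epsilon>) (2 * p - q)))"
  proof (intro sum.cong refl)
    fix \<epsilon> assume \<epsilon>: "\<epsilon> \<in> ?S"
    have sq: "\<epsilon> i * \<epsilon> i = 1" using sign_vectorsD[OF \<epsilon> i] by (elim disjE) simp_all
    have diff: "a \<epsilon> (2 * p + 1) - a (flip i \<epsilon>) (2 * p + 1)
        = 2 * \<epsilon> i * (\<Sum>q<2 * p + 1. a \<epsilon> q * a (flip i \<epsilon>) (2 * p - q))"
      using moment_flip_diff[OF i, where \<epsilon> = \<epsilon> and m = "2 * p + 1"] by (simp add: a_def)
    have "\<epsilon> i * (2 * \<epsilon> i * z) = 2 * z" for z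
      using arg_cong[OF sq, of "\<lambda>w. 2 * w * z"] by (simp add: mult_ac)
    then show "\<epsilon> i * (a \<epsilon> (2 * p + 1) - a (flip i \<epsilon>) (2 * p + 1))
        = 2 * (\<Sum>q<2 * p + 1. a \<epsilon> q * a (flip i \<epsilon>) (2 * p - q))"
      unfolding diff .
  qed
  also have "\<dots> \<le> (\<Sum>\<epsilon>\<in>?S. (2 * real p + 1) * M2 * (a \<epsilon> (2 * p) + a (flip i \<epsilon>) (2 * p)))"
    by (intro sum_mono pair)
  also have "\<dots> = (2 * real p + 1) * M2 * ((\<Sum>\<epsilon>\<in>?S. a \<epsilon> (2 * p)) + (\<Sum>\<epsilon>\<in>?S. a (flip i \<epsilon>) (2 * p)))"
    by (simp only: sum_distrib_left[symmetric] sum.distrib)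
  also have "(\<Sum>\<epsilon>\<in>?S. a (flip i \<epsilon>) (2 * p)) = (\<Sum>\<epsilon>\<in>?S. a \<epsilon> (2 * p))"
    by (rule sum_sign_vectors_flip[OF i])
  finally show ?thesis by (simp add: a_def)
qed

text \<open>Each induction step removes two factors of the operator: \<open>2 * p + 1\<close> counts
  the telescoped terms, \<open>M2\<close> bounds the zeroth moments, and \<open>s\<close> turns the
  sum over \<open>i\<close> back into a trace. The base case is the trace of the identity on the
  span of \<open>E\<close>.\<close>

lemma sum_tr_le:
  assumes M: "\<And>i. i \<in> I \<Longrightarrow> Re (ip (y i) (y i)) \<le> M2" and M0: "0 \<le> M2"
    and s: "\<And>f. f \<in> H \<Longrightarrow> (\<Sum>i\<in>I. (cmod (ip f (y i)))\<^sup>2) \<le> s * Re (ip f f)" and s0: "0 \<le> s"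
  shows "(\<Sum>\<epsilon>\<in>sign_vectors I. tr \<epsilon> (2 * p)) \<le> 2 ^ card I * real (card E) * odd_fact p * (M2 * s) ^ p"
proof (induction p)
  case 0
  show ?case by (simp add: tr_0 card_sign_vectors[OF finite_I])
next
  case (Suc p)
  let ?S = "sign_vectors I"
  have "(\<Sum>\<epsilon>\<in>?S. tr \<epsilon> (2 * Suc p)) = (\<Sum>\<epsilon>\<in>?S. tr \<epsilon> (Suc (2 * p + 1)))" by simp
  also have "\<dots> = (\<Sum>i\<in>I. \<Sum>\<epsilon>\<in>?S. \<epsilon> i * Re (ip (pow \<epsilon> (2 * p + 1) (y i)) (y i)))"
    unfolding tr_Suc by (rule sum.swap)
  also have "\<dots> \<le> (\<Sum>i\<in>I. (2 * real p + 1) * M2 * (\<Sum>\<epsilon>\<in>?S. Re (ip (pow \<epsilon> (2 * p) (y i)) (y i))))"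
    by (rule sum_mono, rule sum_signed_moments_le[OF _ M])
  also have "\<dots> = (2 * real p + 1) * M2 * (\<Sum>\<epsilon>\<in>?S. \<Sum>i\<in>I. Re (ip (pow \<epsilon> (2 * p) (y i)) (y i)))"
    unfolding sum_distrib_left[symmetric] by (subst sum.swap) (rule refl)
  also have "\<dots> \<le> (2 * real p + 1) * M2 * (\<Sum>\<epsilon>\<in>?S. s * tr \<epsilon> (2 * p))"
    using M0 by (intro mult_left_mono sum_mono sum_moments_le_tr[OF s]) auto
  also have "\<dots> = (2 * real p + 1) * M2 * s * (\<Sum>\<epsilon>\<in>?S. tr \<epsilon> (2 * p))"
    unfolding sum_distrib_left[symmetric] by (simp only: mult.assoc)
  also have "\<dots> \<le> (2 * real p + 1) * M2 * s * (2 ^ card I * real (card E) * odd_fact p * (M2 * s) ^ p)"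
    using M0 s0 by (intro mult_left_mono Suc.IH) auto
  finally show ?case by (simp add: mult_ac)
qed

end

context inner_product_function_space
begin

text \<open>The existential \<open>T\<close> hides the orthonormal system behind the trace: all that
  is needed later is one majorant valid for the whole unit ball, with a controlled sum over
  signs.\<close>

lemma rank_one_Khintchine:
  fixes y :: "'i \<Rightarrow> 'a \<Rightarrow> complex"
  assumes I: "finite I" and y: "\<And>i. i \<in> I \<Longrightarrow> y i \<in> H"
    and M: "\<And>i. i \<in> I \<Longrightarrow> Re (ip (y i) (y i)) \<le> M2" and M0: "0 \<le> M2"
    and s: "\<And>f. f \<in> H \<Longrightarrow> (\<Sum>i\<in>I. (cmod (ip f (y i)))\<^sup>2) \<le> s * Re (ip f f)" and s0: "0 \<le> s"
    and p: "p \<ge> 1"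
  shows "\<exists>T. (\<forall>\<epsilon>. \<forall>f\<in>unit_ball H ip. \<bar>\<Sum>i\<in>I. \<epsilon> i * (cmod (ip f (y i)))\<^sup>2\<bar> ^ (2 * p) \<le> T \<epsilon>)
    \<and> (\<Sum>\<epsilon>\<in>sign_vectors I. T \<epsilon>) \<le> 2 ^ card I * real (card I) * odd_fact p * (M2 * s) ^ p"
proof -
  obtain E where E: "finite E" "card E \<le> card I" "E \<subseteq> H"
    "\<forall>e\<in>E. \<forall>e'\<in>E. ip e e' = (if e = e' then 1 else 0)"
    "\<forall>i\<in>I. \<forall>g\<in>H. ip (y i) g = (\<Sum>e\<in>E. ip (y i) e * ip e g)"
    by (rule exE[OF orthonormal_expansion_exists[of I y]], rule I, erule y, elim conjE, rule that)
  interpret vector_family D H ip I y E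
  proof
    show "ip e e = 1" if "e \<in> E" for e using E(4) that by presburger
    show "ip (y i) g = (\<Sum>e\<in>E. ip (y i) e * ip e g)" if "i \<in> I" "g \<in> H" for i g
      using E(5) that by blast
  qed (use E(1,3) I y in blast)+
  have "(\<Sum>\<epsilon>\<in>sign_vectors I. tr \<epsilon> (2 * p)) \<le> 2 ^ card I * real (card E) * odd_fact p * (M2 * s) ^ p"
    by (rule sum_tr_le[OF M M0 s s0])
  also have "\<dots> \<le> 2 ^ card I * real (card I) * odd_fact p * (M2 * s) ^ p"
    using E(2) M0 s0 less_imp_le[OF odd_fact_pos[of p]]
    by (intro mult_right_mono mult_left_mono zero_le_power mult_nonneg_nonneg) simp_all
  finally show ?thesis
    using quadratic_form_le_tr[OF p] by (intro exI[of _ "\<lambda>\<epsilon>. tr \<epsilon> (2 * p)"] conjI allI ballI)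
qed

end

subsection \<open>Symmetrization\<close>

lemma power_add_le_even:
  fixes a b :: real
  shows "(a + b) ^ (2 * p) \<le> 2 ^ (2 * p) * ((a ^ (2 * p) + b ^ (2 * p)) / 2)"
proof -
  have "((1/2) *\<^sub>R a + (1/2) *\<^sub>R b) ^ (2 * p) \<le> (1/2) * a ^ (2 * p) + (1/2) * b ^ (2 * p)"
    using convex_power_even[of "2 * p"] unfolding convex_on_def
    by (metis (no_types, lifting) UNIV_I even_mult_iff even_numeral field_sum_of_halves zero_le_divide_1_iff zero_le_numeral)
  then have "((a + b) / 2) ^ (2 * p) \<le> (a ^ (2 * p) + b ^ (2 * p)) / 2"
    by (simp add: add_divide_distrib)
  then show ?thesis by (simp add: power_divide field_simps)
qed

lemma cSUP_abs_bounds: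
  fixes \<phi> :: "'f \<Rightarrow> real"
  assumes "F \<noteq> {}" "\<And>f. f \<in> F \<Longrightarrow> \<bar>\<phi> f\<bar> \<le> C"
  shows "0 \<le> (SUP f\<in>F. \<bar>\<phi> f\<bar>)" "(SUP f\<in>F. \<bar>\<phi> f\<bar>) \<le> C"
    "f \<in> F \<Longrightarrow> \<bar>\<phi> f\<bar> \<le> (SUP f\<in>F. \<bar>\<phi> f\<bar>)"
proof -
  have bdd: "bdd_above ((\<lambda>f. \<bar>\<phi> f\<bar>) ` F)" using assms(2) by (auto intro!: bdd_aboveI2)
  then show up: "f \<in> F \<Longrightarrow> \<bar>\<phi> f\<bar> \<le> (SUP f\<in>F. \<bar>\<phi> f\<bar>)" for f by (rule cSUP_upper2) auto
  show "0 \<le> (SUP f\<in>F. \<bar>\<phi> f\<bar>)" using assms(1) up by (metis abs_ge_zero ex_in_conv order_trans)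
  show "(SUP f\<in>F. \<bar>\<phi> f\<bar>) \<le> C" by (intro cSUP_least assms)
qed

text \<open>Independent, identically distributed coordinates may be relabelled injectively. This
  serves both the exchange of sample and ghost sample and the restriction to either half of a double
  sample.\<close>

lemma (in prob_space) integral_PiM_reindex:
  fixes \<phi> :: "('i \<Rightarrow> 'a) \<Rightarrow> real" and \<sigma> :: "'i \<Rightarrow> 'j"
  assumes "inj_on \<sigma> I" "\<sigma> \<in> I \<rightarrow> K" and [measurable]: "\<phi> \<in> borel_measurable (PiM I (\<lambda>_. M))"
  shows "(\<integral>\<omega>. \<phi> (\<lambda>i\<in>I. \<omega> (\<sigma> i)) \<partial>PiM K (\<lambda>_. M)) = (\<integral>\<omega>. \<phi> \<omega> \<partial>PiM I (\<lambda>_. M))"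
proof -
  have "distr (PiM K (\<lambda>_. M)) (PiM I (\<lambda>_. M)) (\<lambda>\<omega>. \<lambda>i\<in>I. \<omega> (\<sigma> i)) = PiM I (\<lambda>_. M)"
    using distr_PiM_reindex[of K "\<lambda>_. M" \<sigma> I] assms prob_space_axioms by simp
  moreover have "(\<lambda>\<omega>. \<lambda>i\<in>I. \<omega> (\<sigma> i)) \<in> measurable (PiM K (\<lambda>_. M)) (PiM I (\<lambda>_. M))"
    using assms(2) by (intro measurable_restrict measurable_component_singleton) auto
  ultimately show ?thesis by (metis integral_distr assms(3))
qed

text \<open>Countability of \<open>F\<close> makes the suprema measurable and the common bound
  \<open>B\<close> makes their powers integrable; the unit ball enters later through a countable
  dense part.\<close>

locale bounded_class = prob_space M for M :: "'a measure" +
  fixes F :: "'f set" and g :: "'f \<Rightarrow> 'a \<Rightarrow> real" and B :: real and n :: nat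
  assumes countable_F: "countable F" and F_ne: "F \<noteq> {}"
    and g_meas: "f \<in> F \<Longrightarrow> g f \<in> borel_measurable M"
    and g_bound: "f \<in> F \<Longrightarrow> x \<in> space M \<Longrightarrow> 0 \<le> g f x \<and> g f x \<le> B"
    and n_pos: "n \<ge> 1"
begin

lemma g_meas_component [measurable]:
  "f \<in> F \<Longrightarrow> i \<in> K \<Longrightarrow> (\<lambda>\<omega>. g f (\<omega> i)) \<in> borel_measurable (PiM K (\<lambda>_. M))"
  using g_meas by simp

lemma g_integrable: "f \<in> F \<Longrightarrow> integrable M (g f)"
  using g_bound g_meas by (intro integrable_const_bound[where B = B]) auto

lemma B_nonneg: "0 \<le> B"
  using F_ne g_bound not_empty by (metis ex_in_conv order_trans)

definition deviation :: "(nat \<Rightarrow> 'a) \<Rightarrow> real"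
  where "deviation X = (SUP f\<in>F. \<bar>(\<integral>x. g f x \<partial>M) - 1 / real n * (\<Sum>i\<in>{1..n}. g f (X i))\<bar>)"

definition signed_sup :: "(nat \<Rightarrow> real) \<Rightarrow> (nat \<Rightarrow> 'a) \<Rightarrow> real"
  where "signed_sup \<epsilon> X = (SUP f\<in>F. \<bar>1 / real n * (\<Sum>i\<in>{1..n}. \<epsilon> i * g f (X i))\<bar>)"

text \<open>Sample and ghost sample are stored in one vector of length \<open>n + n\<close>, so that
  exchanging them is a permutation of coordinates.\<close>

definition paired_sup :: "(nat \<Rightarrow> real) \<Rightarrow> (nat \<Rightarrow> 'a) \<Rightarrow> real"
  where "paired_sup \<epsilon> \<omega> = (SUP f\<in>F. \<bar>1 / real n * (\<Sum>i\<in>{1..n}. \<epsilon> i * (g f (\<omega> (n + i)) - g f (\<omega> i)))\<bar>)"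

abbreviation nodes :: "nat set \<Rightarrow> (nat \<Rightarrow> 'a) measure"
  where "nodes K \<equiv> PiM K (\<lambda>_. M)"

lemma prob_space_nodes: "prob_space (nodes K)"
  by (intro prob_space_PiM prob_space_axioms)

lemma component_mem: "\<omega> \<in> space (nodes K) \<Longrightarrow> i \<in> K \<Longrightarrow> \<omega> i \<in> space M"
  by (auto simp: space_PiM)

lemma average_abs_le:
  assumes "\<And>i. i \<in> {1..n} \<Longrightarrow> \<bar>h i\<bar> \<le> C"
  shows "\<bar>1 / real n * (\<Sum>i\<in>{1..n}. h i)\<bar> \<le> C"
proof -
  have "\<bar>\<Sum>i\<in>{1..n}. h i\<bar> \<le> (\<Sum>i\<in>{1..n}. C)"
    using assms by (intro order_trans[OF sum_abs] sum_mono) auto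
  then have "\<bar>\<Sum>i\<in>{1..n}. h i\<bar> \<le> real n * C" by simp
  then show ?thesis using n_pos by (simp add: abs_mult field_simps)
qed

lemma signed_term_le:
  assumes "\<bar>\<epsilon> i\<bar> \<le> 1" "0 \<le> u" "u \<le> B" "0 \<le> v" "v \<le> B"
  shows "\<bar>\<epsilon> i * (u - v)\<bar> \<le> B"
proof -
  have "\<bar>\<epsilon> i * (u - v)\<bar> = \<bar>\<epsilon> i\<bar> * \<bar>u - v\<bar>" by (rule abs_mult)
  also have "\<dots> \<le> 1 * B" using assms by (intro mult_mono) auto
  finally show ?thesis by simp
qed

lemma mean_bounds:
  assumes "f \<in> F" shows "0 \<le> (\<integral>x. g f x \<partial>M)" "(\<integral>x. g f x \<partial>M) \<le> B"
proof -
  show "0 \<le> (\<integral>x. g f x \<partial>M)" using g_bound[OF assms] by (intro integral_nonneg_AE) auto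
  have "(\<integral>x. g f x \<partial>M) \<le> (\<integral>x. B \<partial>M)"
    using g_bound[OF assms] g_integrable[OF assms] by (intro integral_mono_AE) auto
  then show "(\<integral>x. g f x \<partial>M) \<le> B" by (simp add: prob_space)
qed

lemma deviation_term_le:
  assumes "X \<in> space (nodes {1..n})" "f \<in> F"
  shows "\<bar>(\<integral>x. g f x \<partial>M) - 1 / real n * (\<Sum>i\<in>{1..n}. g f (X i))\<bar> \<le> B"
proof -
  have "\<bar>1 / real n * (\<Sum>i\<in>{1..n}. g f (X i))\<bar> \<le> B"
    using g_bound[OF assms(2) component_mem[OF assms(1)]] by (intro average_abs_le) auto
  moreover have "0 \<le> 1 / real n * (\<Sum>i\<in>{1..n}. g f (X i))"
    using g_bound[OF assms(2) component_mem[OF assms(1)]] by (intro mult_nonneg_nonneg sum_nonneg) auto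
  ultimately show ?thesis using mean_bounds[OF assms(2)] by linarith
qed

lemma signed_term_avg_le:
  assumes "X \<in> space (nodes {1..n})" "f \<in> F" "\<And>i. i \<in> {1..n} \<Longrightarrow> \<bar>\<epsilon> i\<bar> \<le> 1"
  shows "\<bar>1 / real n * (\<Sum>i\<in>{1..n}. \<epsilon> i * g f (X i))\<bar> \<le> B"
  using g_bound[OF assms(2) component_mem[OF assms(1)]] assms(3) signed_term_le[of \<epsilon> _ _ 0] B_nonneg
  by (intro average_abs_le) auto

lemma paired_term_avg_le:
  assumes "\<omega> \<in> space (nodes {1..n + n})" "f \<in> F" "\<And>i. i \<in> {1..n} \<Longrightarrow> \<bar>\<epsilon> i\<bar> \<le> 1"
  shows "\<bar>1 / real n * (\<Sum>i\<in>{1..n}. \<epsilon> i * (g f (\<omega> (n + i)) - g f (\<omega> i)))\<bar> \<le> B"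
  using g_bound[OF assms(2) component_mem[OF assms(1)]] assms(3)
  by (intro average_abs_le signed_term_le) auto

lemma deviation_bounds:
  assumes "X \<in> space (nodes {1..n})"
  shows "0 \<le> deviation X" "deviation X \<le> B"
  unfolding deviation_def by (rule cSUP_abs_bounds[OF F_ne deviation_term_le[OF assms]]; assumption)+

lemma signed_sup_bounds:
  assumes "X \<in> space (nodes {1..n})" "\<And>i. i \<in> {1..n} \<Longrightarrow> \<bar>\<epsilon> i\<bar> \<le> 1"
  shows "0 \<le> signed_sup \<epsilon> X" "signed_sup \<epsilon> X \<le> B"
    "f \<in> F \<Longrightarrow> \<bar>1 / real n * (\<Sum>i\<in>{1..n}. \<epsilon> i * g f (X i))\<bar> \<le> signed_sup \<epsilon> X"
  unfolding signed_sup_def by (rule cSUP_abs_bounds[OF F_ne signed_term_avg_le[OF assms(1) _ assms(2)]]; assumption)+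

lemma paired_sup_bounds:
  assumes "\<omega> \<in> space (nodes {1..n + n})" "\<And>i. i \<in> {1..n} \<Longrightarrow> \<bar>\<epsilon> i\<bar> \<le> 1"
  shows "0 \<le> paired_sup \<epsilon> \<omega>" "paired_sup \<epsilon> \<omega> \<le> B"
    "f \<in> F \<Longrightarrow> \<bar>1 / real n * (\<Sum>i\<in>{1..n}. \<epsilon> i * (g f (\<omega> (n + i)) - g f (\<omega> i)))\<bar> \<le> paired_sup \<epsilon> \<omega>"
  unfolding paired_sup_def by (rule cSUP_abs_bounds[OF F_ne paired_term_avg_le[OF assms(1) _ assms(2)]]; assumption)+

lemma deviation_meas [measurable]: "deviation \<in> borel_measurable (nodes {1..n})"
  unfolding deviation_def
  using deviation_term_le by (intro borel_measurable_cSUP countable_F) (auto intro!: bdd_aboveI2)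

lemma signed_sup_meas:
  assumes "\<And>i. i \<in> {1..n} \<Longrightarrow> \<bar>\<epsilon> i\<bar> \<le> 1"
  shows "signed_sup \<epsilon> \<in> borel_measurable (nodes {1..n})"
  unfolding signed_sup_def
  using signed_term_avg_le assms by (intro borel_measurable_cSUP countable_F) (auto intro!: bdd_aboveI2)

lemma paired_sup_meas:
  assumes "\<And>i. i \<in> {1..n} \<Longrightarrow> \<bar>\<epsilon> i\<bar> \<le> 1"
  shows "paired_sup \<epsilon> \<in> borel_measurable (nodes {1..n + n})"
  unfolding paired_sup_def
  using paired_term_avg_le assms by (intro borel_measurable_cSUP countable_F) (auto intro!: bdd_aboveI2)

lemma integrable_power_bounded:
  fixes h :: "'b \<Rightarrow> real"
  assumes "prob_space N" "h \<in> borel_measurable N" "\<And>x. x \<in> space N \<Longrightarrow> 0 \<le> h x \<and> h x \<le> C"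
  shows "integrable N (\<lambda>x. h x ^ m)"
proof -
  interpret N: prob_space N by fact
  have "norm (h x ^ m) \<le> C ^ m" if "x \<in> space N" for x
    using assms(3)[OF that] by (simp add: power_mono)
  then show ?thesis using assms(2) by (intro N.integrable_const_bound[where B = "C ^ m"]) auto
qed

lemma sign_abs_le: "\<epsilon> \<in> sign_vectors {1..n} \<Longrightarrow> i \<in> {1..n} \<Longrightarrow> \<bar>\<epsilon> i\<bar> \<le> 1"
  using sign_vectorsD[of \<epsilon> "{1..n}" i] by auto

text \<open>The coordinates \<open>n + 1, \<dots>, n + n\<close> carry an independent copy of the sample.\<close>

definition ghost :: "nat set" where "ghost = {n + 1..n + n}"

lemma merge_mem:
  assumes "X \<in> space (nodes {1..n})" "Y \<in> space (nodes ghost)"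
  shows "merge {1..n} ghost (X, Y) \<in> space (nodes {1..n + n})"
proof -
  have eq: "{1..n} \<union> ghost = {1..n + n}" by (auto simp: ghost_def)
  have "merge {1..n} ghost \<in> measurable (nodes {1..n} \<Otimes>\<^sub>M nodes ghost) (nodes ({1..n} \<union> ghost))"
    by (rule measurable_merge)
  from measurable_space[OF this, of "(X, Y)"] show ?thesis using assms unfolding eq by (simp add: space_pair_measure)
qed

lemma merge_simps:
  "i \<in> {1..n} \<Longrightarrow> merge {1..n} ghost (X, Y) i = X i"
  "i \<in> {1..n} \<Longrightarrow> merge {1..n} ghost (X, Y) (n + i) = Y (n + i)"
  by (auto simp: merge_def ghost_def)

lemma merge_meas:
  assumes "X \<in> space (nodes {1..n})"
  shows "(\<lambda>Y. merge {1..n} ghost (X, Y)) \<in> measurable (nodes ghost) (nodes {1..n + n})"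
proof -
  have eq: "{1..n} \<union> ghost = {1..n + n}" by (auto simp: ghost_def)
  have "(\<lambda>Y. merge {1..n} ghost (X, Y)) \<in> measurable (nodes ghost) (nodes ({1..n} \<union> ghost))"
    using assms by (intro measurable_compose[OF measurable_Pair1' measurable_merge])
  then show ?thesis by (simp only: eq)
qed

text \<open>The true mean is the ghost integral of the ghost average. Pulling this integral out of
  the absolute value and the supremum, then out of the even power by Jensen, gives the
  bound.\<close>

lemma deviation_le_ghost:
  assumes X: "X \<in> space (nodes {1..n})"
  shows "deviation X ^ (2 * p) \<le> (\<integral>Y. paired_sup (\<lambda>_. 1) (merge {1..n} ghost (X, Y)) ^ (2 * p) \<partial>nodes ghost)"
proof -
  interpret G: prob_space "nodes ghost" by (rule prob_space_nodes)
  define W where "W Y = paired_sup (\<lambda>_. 1) (merge {1..n} ghost (X, Y))" for Y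
  have Wm[measurable]: "W \<in> borel_measurable (nodes ghost)"
    unfolding W_def by (rule measurable_compose[OF merge_meas[OF X] paired_sup_meas]) simp
  have Wb: "0 \<le> W Y \<and> W Y \<le> B" if "Y \<in> space (nodes ghost)" for Y
    unfolding W_def using paired_sup_bounds(1,2)[OF merge_mem[OF X that], of "\<lambda>_. 1"] by simp
  have Wi: "integrable (nodes ghost) (\<lambda>Y. W Y ^ m)" for m
    by (rule integrable_power_bounded[OF prob_space_nodes Wm Wb])
  have Wi1: "integrable (nodes ghost) W" using Wi[of 1] by simp
  have "deviation X \<le> (\<integral>Y. W Y \<partial>nodes ghost)"
    unfolding deviation_def
  proof (rule cSUP_least[OF F_ne])
    fix f assume f: "f \<in> F"
    have comp: "(\<integral>Y. g f (Y (n + i)) \<partial>nodes ghost) = (\<integral>x. g f x \<partial>M)"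
      and compi: "integrable (nodes ghost) (\<lambda>Y. g f (Y (n + i)))" if "i \<in> {1..n}" for i
    proof -
      have i: "n + i \<in> ghost" using that by (auto simp: ghost_def)
      have d: "distr (nodes ghost) M (\<lambda>\<omega>. \<omega> (n + i)) = M"
        by (rule distr_PiM_component[OF _ i]) (rule prob_space_axioms)
      have "(\<integral>x. g f x \<partial>distr (nodes ghost) M (\<lambda>\<omega>. \<omega> (n + i))) = (\<integral>Y. g f (Y (n + i)) \<partial>nodes ghost)"
        using i g_meas[OF f] by (intro integral_distr) auto
      then show "(\<integral>Y. g f (Y (n + i)) \<partial>nodes ghost) = (\<integral>x. g f x \<partial>M)" by (simp add: d)
      show "integrable (nodes ghost) (\<lambda>Y. g f (Y (n + i)))"
        using g_bound[OF f component_mem[OF _ i]] g_meas_component[OF f i]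
        by (intro G.integrable_const_bound[where B = B]) auto
    qed
    define h where "h Y = 1 / real n * (\<Sum>i\<in>{1..n}. g f (Y (n + i)) - g f (X i))" for Y
    have hi: "integrable (nodes ghost) h"
      unfolding h_def using compi by (intro integrable_mult_right Bochner_Integration.integrable_sum Bochner_Integration.integrable_diff) auto
    have "(\<integral>Y. h Y \<partial>nodes ghost) = 1 / real n * (\<Sum>i\<in>{1..n}. (\<integral>x. g f x \<partial>M) - g f (X i))"
      unfolding h_def using compi comp by (simp add: Bochner_Integration.integral_sum G.prob_space)
    also have "\<dots> = (\<integral>x. g f x \<partial>M) - 1 / real n * (\<Sum>i\<in>{1..n}. g f (X i))"
      using n_pos by (simp add: sum_subtractf field_simps)
    finally have "\<bar>(\<integral>x. g f x \<partial>M) - 1 / real n * (\<Sum>i\<in>{1..n}. g f (X i))\<bar> = \<bar>\<integral>Y. h Y \<partial>nodes ghost\<bar>"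
      by simp
    also have "\<dots> \<le> (\<integral>Y. \<bar>h Y\<bar> \<partial>nodes ghost)" by (rule integral_abs_bound)
    also have "\<dots> \<le> (\<integral>Y. W Y \<partial>nodes ghost)"
    proof (rule integral_mono[OF _ Wi1])
      show "integrable (nodes ghost) (\<lambda>Y. \<bar>h Y\<bar>)" using hi by simp
      fix Y assume Y: "Y \<in> space (nodes ghost)"
      have "h Y = 1 / real n * (\<Sum>i\<in>{1..n}. 1 * (g f (merge {1..n} ghost (X, Y) (n + i))
          - g f (merge {1..n} ghost (X, Y) i)))"
        unfolding h_def by (intro arg_cong2[where f = "(*)"] sum.cong refl) (simp only: merge_simps mult_1)
      then show "\<bar>h Y\<bar> \<le> W Y"
        using paired_sup_bounds(3)[OF merge_mem[OF X Y] _ f, of "\<lambda>_. 1"]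
        unfolding W_def by simp
    qed
    finally show "\<bar>(\<integral>x. g f x \<partial>M) - 1 / real n * (\<Sum>i\<in>{1..n}. g f (X i))\<bar> \<le> (\<integral>Y. W Y \<partial>nodes ghost)" .
  qed
  then have "deviation X ^ (2 * p) \<le> (\<integral>Y. W Y \<partial>nodes ghost) ^ (2 * p)"
    using deviation_bounds(1)[OF X] by (intro power_mono)
  also have "\<dots> \<le> (\<integral>Y. W Y ^ (2 * p) \<partial>nodes ghost)"
    by (rule G.jensens_inequality[where I = UNIV and q = "\<lambda>x. x ^ (2 * p)"])
      (auto intro: Wi Wi1 convex_power_even)
  finally show ?thesis by (simp add: W_def)
qed

text \<open>Swaps \<open>i\<close> and \<open>n + i\<close> wherever the sign is not 1. As an
  involution of the coordinates it preserves the product measure, and a swap reverses the sign of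
  the paired difference.\<close>

definition exchange :: "(nat \<Rightarrow> real) \<Rightarrow> nat \<Rightarrow> nat"
  where "exchange \<epsilon> k = (if k \<le> n then (if \<epsilon> k = 1 then k else n + k)
    else (if \<epsilon> (k - n) = 1 then k else k - n))"

lemma exchange_mem: "k \<in> {1..n + n} \<Longrightarrow> exchange \<epsilon> k \<in> {1..n + n}"
  by (auto simp: exchange_def)

lemma exchange_exchange: "k \<in> {1..n + n} \<Longrightarrow> exchange \<epsilon> (exchange \<epsilon> k) = k"
  by (auto simp: exchange_def)

lemma paired_sup_exchange:
  assumes "\<epsilon> \<in> sign_vectors {1..n}"
  shows "paired_sup (\<lambda>_. 1) (\<lambda>k\<in>{1..n + n}. \<omega> (exchange \<epsilon> k)) = paired_sup \<epsilon> \<omega>"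
proof -
  have "(\<Sum>i\<in>{1..n}. 1 * (g f ((\<lambda>k\<in>{1..n + n}. \<omega> (exchange \<epsilon> k)) (n + i))
        - g f ((\<lambda>k\<in>{1..n + n}. \<omega> (exchange \<epsilon> k)) i)))
      = (\<Sum>i\<in>{1..n}. \<epsilon> i * (g f (\<omega> (n + i)) - g f (\<omega> i)))" for f
  proof (intro sum.cong refl)
    fix i assume i: "i \<in> {1..n}"
    show "1 * (g f ((\<lambda>k\<in>{1..n + n}. \<omega> (exchange \<epsilon> k)) (n + i))
        - g f ((\<lambda>k\<in>{1..n + n}. \<omega> (exchange \<epsilon> k)) i)) = \<epsilon> i * (g f (\<omega> (n + i)) - g f (\<omega> i))"
      using sign_vectorsD[OF assms i] i by (elim disjE) (simp_all add: exchange_def)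
  qed
  then show ?thesis unfolding paired_sup_def by (simp only:)
qed

text \<open>Exchange invariance inserts the signs, then the triangle inequality separates the two
  halves. These have the same law, so convexity of the even power costs only
  \<open>2 ^ (2 * p)\<close>.\<close>

lemma paired_sup_moment_le:
  assumes \<epsilon>: "\<epsilon> \<in> sign_vectors {1..n}"
  shows "(\<integral>\<omega>. paired_sup (\<lambda>_. 1) \<omega> ^ (2 * p) \<partial>nodes {1..n + n})
    \<le> 2 ^ (2 * p) * (\<integral>X. signed_sup \<epsilon> X ^ (2 * p) \<partial>nodes {1..n})"
proof -
  let ?Q = "nodes {1..n + n}" and ?P = "nodes {1..n}"
  note \<epsilon>1 = sign_abs_le[OF \<epsilon>]
  let ?lo = "\<lambda>\<omega>. \<lambda>i\<in>{1..n}. \<omega> i" and ?hi = "\<lambda>\<omega>. \<lambda>i\<in>{1..n}. \<omega> (n + i)"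
  have lo: "?lo \<omega> \<in> space ?P" and hi: "?hi \<omega> \<in> space ?P" if "\<omega> \<in> space ?Q" for \<omega>
    using component_mem[OF that] by (auto simp: space_PiM)
  have lom: "?lo \<in> measurable ?Q ?P" and him: "?hi \<in> measurable ?Q ?P"
    by (auto intro!: measurable_restrict measurable_component_singleton)
  note sm = signed_sup_meas[OF \<epsilon>1]
  have sb: "0 \<le> signed_sup \<epsilon> X \<and> signed_sup \<epsilon> X \<le> B" if "X \<in> space ?P" for X
    using signed_sup_bounds(1,2)[OF that \<epsilon>1] by simp
  have sum_le: "paired_sup \<epsilon> \<omega> \<le> signed_sup \<epsilon> (?lo \<omega>) + signed_sup \<epsilon> (?hi \<omega>)" if w: "\<omega> \<in> space ?Q" for \<omega>
    unfolding paired_sup_def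
  proof (rule cSUP_least[OF F_ne])
    fix f assume f: "f \<in> F"
    have "1 / real n * (\<Sum>i\<in>{1..n}. \<epsilon> i * (g f (\<omega> (n + i)) - g f (\<omega> i)))
      = 1 / real n * (\<Sum>i\<in>{1..n}. \<epsilon> i * g f (?hi \<omega> i)) - 1 / real n * (\<Sum>i\<in>{1..n}. \<epsilon> i * g f (?lo \<omega> i))"
      by (simp add: right_diff_distrib sum_subtractf)
    then show "\<bar>1 / real n * (\<Sum>i\<in>{1..n}. \<epsilon> i * (g f (\<omega> (n + i)) - g f (\<omega> i)))\<bar>
        \<le> signed_sup \<epsilon> (?lo \<omega>) + signed_sup \<epsilon> (?hi \<omega>)"
      using signed_sup_bounds(3)[where \<epsilon> = \<epsilon>, OF lo[OF w] \<epsilon>1 f]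
        signed_sup_bounds(3)[where \<epsilon> = \<epsilon>, OF hi[OF w] \<epsilon>1 f] by linarith
  qed
  have "(\<integral>\<omega>. paired_sup (\<lambda>_. 1) \<omega> ^ (2 * p) \<partial>?Q)
      = (\<integral>\<omega>. paired_sup (\<lambda>_. 1) (\<lambda>k\<in>{1..n + n}. \<omega> (exchange \<epsilon> k)) ^ (2 * p) \<partial>?Q)"
    using exchange_mem exchange_exchange
    by (intro integral_PiM_reindex[symmetric] borel_measurable_power paired_sup_meas)
      (auto intro!: inj_on_inverseI[where g = "exchange \<epsilon>"])
  also have "\<dots> = (\<integral>\<omega>. paired_sup \<epsilon> \<omega> ^ (2 * p) \<partial>?Q)" by (simp only: paired_sup_exchange[OF \<epsilon>])
  also have "\<dots> \<le> (\<integral>\<omega>. 2 ^ (2 * p) * ((signed_sup \<epsilon> (?lo \<omega>) ^ (2 * p) + signed_sup \<epsilon> (?hi \<omega>) ^ (2 * p)) / 2) \<partial>?Q)"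
  proof (rule integral_mono)
    show "integrable ?Q (\<lambda>\<omega>. paired_sup \<epsilon> \<omega> ^ (2 * p))"
      using paired_sup_bounds(1,2)[OF _ \<epsilon>1]
      by (intro integrable_power_bounded[OF prob_space_nodes paired_sup_meas[OF \<epsilon>1]]) auto
    have "integrable ?Q (\<lambda>\<omega>. signed_sup \<epsilon> (?lo \<omega>) ^ (2 * p))"
      by (rule integrable_power_bounded[OF prob_space_nodes measurable_compose[OF lom sm] sb[OF lo]])
    moreover have "integrable ?Q (\<lambda>\<omega>. signed_sup \<epsilon> (?hi \<omega>) ^ (2 * p))"
      by (rule integrable_power_bounded[OF prob_space_nodes measurable_compose[OF him sm] sb[OF hi]])
    ultimately show "integrable ?Q (\<lambda>\<omega>. 2 ^ (2 * p) * ((signed_sup \<epsilon> (?lo \<omega>) ^ (2 * p) + signed_sup \<epsilon> (?hi \<omega>) ^ (2 * p)) / 2))"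
      by (intro integrable_mult_right integrable_divide_zero Bochner_Integration.integrable_add)
    fix \<omega> assume w: "\<omega> \<in> space ?Q"
    have "paired_sup \<epsilon> \<omega> ^ (2 * p) \<le> (signed_sup \<epsilon> (?lo \<omega>) + signed_sup \<epsilon> (?hi \<omega>)) ^ (2 * p)"
      by (rule power_mono[OF sum_le[OF w] paired_sup_bounds(1)[OF w \<epsilon>1]])
    also have "\<dots> \<le> 2 ^ (2 * p) * ((signed_sup \<epsilon> (?lo \<omega>) ^ (2 * p) + signed_sup \<epsilon> (?hi \<omega>) ^ (2 * p)) / 2)"
      by (rule power_add_le_even)
    finally show "paired_sup \<epsilon> \<omega> ^ (2 * p)
      \<le> 2 ^ (2 * p) * ((signed_sup \<epsilon> (?lo \<omega>) ^ (2 * p) + signed_sup \<epsilon> (?hi \<omega>) ^ (2 * p)) / 2)" .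
  qed
  also have "\<dots> = 2 ^ (2 * p) * (((\<integral>\<omega>. signed_sup \<epsilon> (?lo \<omega>) ^ (2 * p) \<partial>?Q)
      + (\<integral>\<omega>. signed_sup \<epsilon> (?hi \<omega>) ^ (2 * p) \<partial>?Q)) / 2)"
    using integrable_power_bounded[OF prob_space_nodes measurable_compose[OF lom sm] sb[OF lo]]
      integrable_power_bounded[OF prob_space_nodes measurable_compose[OF him sm] sb[OF hi]]
    by (simp add: Bochner_Integration.integral_add)
  also have "(\<integral>\<omega>. signed_sup \<epsilon> (?lo \<omega>) ^ (2 * p) \<partial>?Q) = (\<integral>X. signed_sup \<epsilon> X ^ (2 * p) \<partial>?P)"
    using sm by (intro integral_PiM_reindex[of "\<lambda>i. i"]) auto
  also have "(\<integral>\<omega>. signed_sup \<epsilon> (?hi \<omega>) ^ (2 * p) \<partial>?Q) = (\<integral>X. signed_sup \<epsilon> X ^ (2 * p) \<partial>?P)"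
    using sm by (intro integral_PiM_reindex[of "\<lambda>i. n + i"]) (auto simp: inj_on_def)
  finally show ?thesis by simp
qed

text \<open>The pointwise ghost bound is integrated over the sample, and Fubini fuses both integrals
  into one over \<open>n + n\<close> nodes.\<close>

lemma deviation_moment_le_paired:
  "(\<integral>X. deviation X ^ (2 * p) \<partial>nodes {1..n}) \<le> (\<integral>\<omega>. paired_sup (\<lambda>_. 1) \<omega> ^ (2 * p) \<partial>nodes {1..n + n})"
proof -
  let ?h = "\<lambda>\<omega>. paired_sup (\<lambda>_. 1) \<omega> ^ (2 * p)"
  interpret G: prob_space "nodes ghost" by (rule prob_space_nodes)
  interpret P: prob_space "nodes {1..n}" by (rule prob_space_nodes)
  interpret S: product_sigma_finite "\<lambda>_::nat. M"
    by unfold_locales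
  have eq: "{1..n} \<union> ghost = {1..n + n}" by (auto simp: ghost_def)
  have hm: "?h \<in> borel_measurable (nodes {1..n + n})"
    by (intro borel_measurable_power paired_sup_meas) simp
  have hi: "integrable (nodes {1..n + n}) ?h"
    using paired_sup_bounds(1,2)[of _ "\<lambda>_. 1"]
    by (intro integrable_power_bounded[OF prob_space_nodes paired_sup_meas]) auto
  have mm: "(\<lambda>(X, Y). ?h (merge {1..n} ghost (X, Y))) \<in> borel_measurable (nodes {1..n} \<Otimes>\<^sub>M nodes ghost)"
  proof -
    have "merge {1..n} ghost \<in> measurable (nodes {1..n} \<Otimes>\<^sub>M nodes ghost) (nodes {1..n + n})"
      unfolding eq[symmetric] by (rule measurable_merge)
    from measurable_compose[OF this hm] show ?thesis by (simp add: case_prod_unfold)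
  qed
  have hb: "0 \<le> ?h (merge {1..n} ghost (X, Y)) \<and> ?h (merge {1..n} ghost (X, Y)) \<le> B ^ (2 * p)"
    if "X \<in> space (nodes {1..n})" "Y \<in> space (nodes ghost)" for X Y
    using paired_sup_bounds(1,2)[OF merge_mem[OF that], of "\<lambda>_. 1"] by (simp add: power_mono)
  have "(\<integral>X. deviation X ^ (2 * p) \<partial>nodes {1..n})
      \<le> (\<integral>X. (\<integral>Y. ?h (merge {1..n} ghost (X, Y)) \<partial>nodes ghost) \<partial>nodes {1..n})"
  proof (rule integral_mono[OF _ _ deviation_le_ghost])
    show "integrable (nodes {1..n}) (\<lambda>X. deviation X ^ (2 * p))"
      using deviation_bounds(1,2) by (intro integrable_power_bounded[OF prob_space_nodes deviation_meas]) auto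
    have "norm (\<integral>Y. ?h (merge {1..n} ghost (X, Y)) \<partial>nodes ghost) \<le> B ^ (2 * p)"
      if X: "X \<in> space (nodes {1..n})" for X
    proof -
      have "norm (\<integral>Y. ?h (merge {1..n} ghost (X, Y)) \<partial>nodes ghost) \<le> (\<integral>Y. norm (?h (merge {1..n} ghost (X, Y))) \<partial>nodes ghost)"
        by (rule integral_norm_bound)
      also have "\<dots> \<le> (\<integral>Y. B ^ (2 * p) \<partial>nodes ghost)"
        using hb[OF X] measurable_compose[OF merge_meas[OF X] hm]
        by (intro integral_mono G.integrable_const_bound[where B = "B ^ (2 * p)"]) auto
      finally show ?thesis by (simp add: G.prob_space)
    qed
    then show "integrable (nodes {1..n}) (\<lambda>X. \<integral>Y. ?h (merge {1..n} ghost (X, Y)) \<partial>nodes ghost)"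
      using G.borel_measurable_lebesgue_integral[OF mm]
      by (intro P.integrable_const_bound[where B = "B ^ (2 * p)"]) auto
  qed
  also have "\<dots> = (\<integral>\<omega>. ?h \<omega> \<partial>nodes ({1..n} \<union> ghost))"
    by (intro S.product_integral_fold[symmetric] hi[folded eq]) (auto simp: ghost_def)
  finally show ?thesis by (simp only: eq)
qed

text \<open>The bound holds for every single sign vector, but the Khintchine inequality controls
  only the sum over all of them.\<close>

lemma symmetrization:
  "2 ^ n * (\<integral>X. deviation X ^ (2 * p) \<partial>nodes {1..n})
    \<le> 2 ^ (2 * p) * (\<Sum>\<epsilon>\<in>sign_vectors {1..n}. \<integral>X. signed_sup \<epsilon> X ^ (2 * p) \<partial>nodes {1..n})"
proof -
  have "2 ^ n * (\<integral>X. deviation X ^ (2 * p) \<partial>nodes {1..n})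
      = (\<Sum>\<epsilon>\<in>sign_vectors {1..n}. \<integral>X. deviation X ^ (2 * p) \<partial>nodes {1..n})"
    by (simp add: card_sign_vectors)
  also have "\<dots> \<le> (\<Sum>\<epsilon>\<in>sign_vectors {1..n}. 2 ^ (2 * p) * (\<integral>X. signed_sup \<epsilon> X ^ (2 * p) \<partial>nodes {1..n}))"
    by (intro sum_mono order_trans[OF deviation_moment_le_paired paired_sup_moment_le])
  finally show ?thesis by (simp only: sum_distrib_left)
qed

end

subsection \<open>The tail bound for bounded classes\<close>

text \<open>Trades the power \<open>p\<close> of \<open>1 + z\<close> for the power
  \<open>2 * p\<close> of \<open>z\<close>, so that the self-bounding inequality closes with a
  single moment. For \<open>z > 1\<close> one has \<open>1 + z <= 2 z^2\<close>.\<close>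

lemma one_plus_power_le:
  fixes z :: real
  assumes "0 \<le> z"
  shows "(1 + z) ^ p \<le> 2 ^ p * (1 + z ^ (2 * p))"
proof (cases "z \<le> 1")
  case True
  then have "(1 + z) ^ p \<le> 2 ^ p" using assms by (intro power_mono) auto
  also have "\<dots> \<le> 2 ^ p * (1 + z ^ (2 * p))" using assms by simp
  finally show ?thesis .
next
  case False
  then have "z * 1 \<le> z * z" by (intro mult_left_mono) auto
  then have "1 + z \<le> 2 * z\<^sup>2" using False unfolding power2_eq_square by linarith
  then have "(1 + z) ^ p \<le> (2 * z\<^sup>2) ^ p" using assms by (intro power_mono) auto
  also have "\<dots> = 2 ^ p * z ^ (2 * p)" by (simp add: power_mult_distrib power_mult)
  also have "\<dots> \<le> 2 ^ p * (1 + z ^ (2 * p))" by (intro mult_left_mono) auto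
  finally show ?thesis .
qed

context bounded_class
begin

text \<open>The moment \<open>\<beta>\<close> returns on the right because the Khintchine bound
  contains the deviation itself. The 8 is 4 from symmetrization times 2 from
  \<open>one_plus_power_le\<close>.\<close>

lemma normalized_moment_le:
  assumes lam: "lam > 0" and V: "V > 0"
    and Kh: "\<And>X. X \<in> space (nodes {1..n}) \<Longrightarrow>
      (\<Sum>\<epsilon>\<in>sign_vectors {1..n}. signed_sup \<epsilon> X ^ (2 * p))
        \<le> 2 ^ n * (real n * odd_fact p * (V * (lam + deviation X) / real n) ^ p)"
  defines "\<beta> \<equiv> (\<integral>X. (deviation X / lam) ^ (2 * p) \<partial>nodes {1..n})"
  shows "\<beta> \<le> real n * (8 * V / (real n * lam)) ^ p * odd_fact p * (1 + \<beta>)"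
proof -
  let ?P = "nodes {1..n}"
  interpret P: prob_space ?P by (rule prob_space_nodes)
  define b where "b = (\<integral>X. deviation X ^ (2 * p) \<partial>?P)"
  have \<beta>: "\<beta> = b / lam ^ (2 * p)" by (simp add: \<beta>_def b_def power_divide)
  have di: "integrable ?P (\<lambda>X. (deviation X / lam) ^ m)" for m
    using deviation_bounds lam
    by (intro integrable_power_bounded[OF prob_space_nodes
        borel_measurable_divide[OF deviation_meas borel_measurable_const], where C = "B / lam"]) (auto simp: divide_right_mono)
  have si: "integrable ?P (\<lambda>X. signed_sup \<epsilon> X ^ (2 * p))" if "\<epsilon> \<in> sign_vectors {1..n}" for \<epsilon>
    using signed_sup_bounds(1,2)[OF _ sign_abs_le[OF that]]
    by (intro integrable_power_bounded[OF prob_space_nodes signed_sup_meas[OF sign_abs_le[OF that]]]) auto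
  define A where "A = real n * odd_fact p * (2 * V * lam / real n) ^ p"
  have A0: "0 \<le> A" unfolding A_def using odd_fact_pos[of p] lam V by simp
  have "2 ^ n * b \<le> 2 ^ (2 * p) * (\<Sum>\<epsilon>\<in>sign_vectors {1..n}. \<integral>X. signed_sup \<epsilon> X ^ (2 * p) \<partial>?P)"
    unfolding b_def by (rule symmetrization)
  also have "(\<Sum>\<epsilon>\<in>sign_vectors {1..n}. \<integral>X. signed_sup \<epsilon> X ^ (2 * p) \<partial>?P)
      = (\<integral>X. (\<Sum>\<epsilon>\<in>sign_vectors {1..n}. signed_sup \<epsilon> X ^ (2 * p)) \<partial>?P)"
    using si by (rule Bochner_Integration.integral_sum[symmetric])
  also have "2 ^ (2 * p) * \<dots> \<le> 2 ^ (2 * p) * (\<integral>X. 2 ^ n * (A * (1 + (deviation X / lam) ^ (2 * p))) \<partial>?P)"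
  proof (intro mult_left_mono integral_mono)
    show "integrable ?P (\<lambda>X. \<Sum>\<epsilon>\<in>sign_vectors {1..n}. signed_sup \<epsilon> X ^ (2 * p))"
      using si by (rule Bochner_Integration.integrable_sum)
    show "integrable ?P (\<lambda>X. 2 ^ n * (A * (1 + (deviation X / lam) ^ (2 * p))))"
      by (intro integrable_mult_right Bochner_Integration.integrable_add di P.integrable_const)
    fix X assume X: "X \<in> space ?P"
    have "V * (lam + deviation X) / real n = V * lam / real n * (1 + deviation X / lam)"
    proof -
      have "lam + deviation X = lam * (1 + deviation X / lam)" using lam by (simp add: distrib_left)
      then show ?thesis by (simp only: times_divide_eq_left mult.assoc)
    qed
    then have "(V * (lam + deviation X) / real n) ^ p = (V * lam / real n) ^ p * (1 + deviation X / lam) ^ p"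
      by (simp only: power_mult_distrib)
    also have "\<dots> \<le> (V * lam / real n) ^ p * (2 ^ p * (1 + (deviation X / lam) ^ (2 * p)))"
      using lam V deviation_bounds(1)[OF X] by (intro mult_left_mono one_plus_power_le) auto
    also have "\<dots> = (2 * V * lam / real n) ^ p * (1 + (deviation X / lam) ^ (2 * p))"
      by (simp add: power_mult_distrib power_divide)
    finally have "real n * odd_fact p * (V * (lam + deviation X) / real n) ^ p
        \<le> real n * odd_fact p * ((2 * V * lam / real n) ^ p * (1 + (deviation X / lam) ^ (2 * p)))"
      using odd_fact_pos[of p] by (intro mult_left_mono) auto
    then have "real n * odd_fact p * (V * (lam + deviation X) / real n) ^ p
        \<le> A * (1 + (deviation X / lam) ^ (2 * p))"
      by (simp add: A_def mult_ac)
    then show "(\<Sum>\<epsilon>\<in>sign_vectors {1..n}. signed_sup \<epsilon> X ^ (2 * p))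
        \<le> 2 ^ n * (A * (1 + (deviation X / lam) ^ (2 * p)))"
      by (intro order_trans[OF Kh[OF X]] mult_left_mono) auto
  qed simp
  also have "\<dots> = 2 ^ n * (2 ^ (2 * p) * (A * (1 + \<beta>)))"
  proof -
    have "(\<integral>X. 1 + (deviation X / lam) ^ (2 * p) \<partial>?P) = 1 + \<beta>"
      using Bochner_Integration.integral_add[OF P.integrable_const di, of 1 "2 * p"]
      by (simp only: \<beta>_def lebesgue_integral_const P.prob_space scaleR_one)
    then show ?thesis by simp
  qed
  finally have "b \<le> 2 ^ (2 * p) * (A * (1 + \<beta>))" by simp
  then have "\<beta> \<le> 2 ^ (2 * p) * (A * (1 + \<beta>)) / lam ^ (2 * p)"
    unfolding \<beta> using lam by (intro divide_right_mono) auto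
  also have "\<dots> = real n * (8 * V / (real n * lam)) ^ p * odd_fact p * (1 + \<beta>)"
  proof -
    have "(4::real) * (2 * V * lam / real n) / (lam * lam) = 8 * V / (real n * lam)"
      using lam by simp
    then have "(8 * V / (real n * lam)) ^ p = 4 ^ p * (2 * V * lam / real n) ^ p / (lam * lam) ^ p"
      by (metis power_divide power_mult_distrib)
    then show ?thesis
      by (simp add: A_def power_mult power2_eq_square)
  qed
  finally show ?thesis .
qed

lemma deviation_tail:
  assumes lam: "lam > 0" and V: "lam \<le> V" and t: "0 < t" "t \<le> 1"
    and Kh: "\<And>X p. p \<ge> 1 \<Longrightarrow> X \<in> space (nodes {1..n}) \<Longrightarrow>
      (\<Sum>\<epsilon>\<in>sign_vectors {1..n}. signed_sup \<epsilon> X ^ (2 * p))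
        \<le> 2 ^ n * (real n * odd_fact p * (V * (lam + deviation X) / real n) ^ p)"
  shows "measure (nodes {1..n}) {X \<in> space (nodes {1..n}). deviation X > t * lam}
    \<le> 2 powr (3 / 4) * real n * exp (- (real n * t\<^sup>2 * lam / (21 * V)))"
proof -
  let ?P = "nodes {1..n}"
  interpret P: prob_space ?P by (rule prob_space_nodes)
  define y where "y = real n * t\<^sup>2 * lam / V"
  have V0: "V > 0" using lam V by simp
  have y0: "y > 0" using lam V0 t n_pos by (simp add: y_def)
  have y21: "real n * t\<^sup>2 * lam / (21 * V) = y / 21" by (simp add: y_def)
  show ?thesis
  proof (cases "2 powr (3/4) * real n \<le> exp (y / 21)")
    case False
    then have "1 \<le> 2 powr (3/4) * real n * exp (- (y / 21))"
      by (simp add: exp_minus field_simps)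
    then show ?thesis unfolding y21 using P.prob_le_1 order_trans by blast
  next
    case True
    have "t\<^sup>2 \<le> 1" using t by (simp add: power_le_one)
    then have "t\<^sup>2 * lam \<le> 1 * V" using lam V by (intro mult_mono) auto
    \<comment> \<open>This is the input that makes the bootstrap of \<open>tail_parameter_ge\<close>
      work.\<close>
    then have "y \<le> real n"
      using V0 mult_left_mono[of "t\<^sup>2 * lam" V "real n"] by (simp add: y_def field_simps)
    then obtain p where p: "p \<ge> 1"
      and w: "real n * (8 / y) ^ p * odd_fact p \<le> 2 powr (3/4) * real n * exp (- (y / 21)) / 2"
      using ex_moment_order[OF n_pos _ True] by blast
    define c where "c = real n * (8 * V / (real n * lam)) ^ p * odd_fact p"
    define w' where "w' = real n * (8 / y) ^ p * odd_fact p"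
    define \<beta> where "\<beta> = (\<integral>X. (deviation X / lam) ^ (2 * p) \<partial>?P)"
    have cw: "c = w' * t ^ (2 * p)"
    proof -
      \<comment> \<open>The resulting factor \<open>t ^ (2 * p)\<close> cancels the denominator in
        Markov's inequality and leaves \<open>2 * w'\<close>.\<close>
      have "8 * V / (real n * lam) = 8 / y * t\<^sup>2"
        using t lam V0 n_pos by (simp add: y_def)
      then have "(8 * V / (real n * lam)) ^ p = (8 / y) ^ p * t ^ (2 * p)"
        by (simp only: power_mult_distrib power_mult)
      then show ?thesis by (simp only: c_def w'_def mult_ac)
    qed
    have w'0: "0 \<le> w'" using y0 odd_fact_pos[of p] by (simp add: w'_def)
    have "2 powr (3/4) * real n * exp (- (y / 21)) \<le> 1"
      using True by (simp add: exp_minus field_simps)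
    then have w'1: "w' \<le> 1 / 2" using w by (simp add: w'_def)
    have "t ^ (2 * p) \<le> 1" using t by (simp add: power_le_one)
    then have "c \<le> w' * 1" unfolding cw using w'0 by (intro mult_left_mono)
    then have c2: "c \<le> 1 / 2" using w'1 by simp
    have \<beta>0: "0 \<le> \<beta>" by (simp add: \<beta>_def)
    have "\<beta> \<le> c * (1 + \<beta>)"
      unfolding c_def \<beta>_def by (rule normalized_moment_le[OF lam V0 Kh[OF p]])
    \<comment> \<open>Since \<open>c\<close> is at most \<open>1 / 2\<close>, the moment on the
      right is absorbed by the left side at the cost of a factor 2.\<close>
    also have "\<dots> \<le> c + 1 / 2 * \<beta>" using mult_right_mono[OF c2 \<beta>0] by (simp add: algebra_simps)
    finally have \<beta>c: "\<beta> \<le> 2 * c" by simp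
    have di: "integrable ?P (\<lambda>X. (deviation X / lam) ^ (2 * p))"
      using deviation_bounds lam
      by (intro integrable_power_bounded[OF prob_space_nodes
        borel_measurable_divide[OF deviation_meas borel_measurable_const], where C = "B / lam"]) (auto simp: divide_right_mono)
    have "measure ?P {X \<in> space ?P. deviation X > t * lam}
        \<le> measure ?P {X \<in> space ?P. (deviation X / lam) ^ (2 * p) \<ge> t ^ (2 * p)}"
    proof (rule P.finite_measure_mono)
      show "{X \<in> space ?P. deviation X > t * lam} \<subseteq> {X \<in> space ?P. (deviation X / lam) ^ (2 * p) \<ge> t ^ (2 * p)}"
      proof safe
        fix X assume "deviation X > t * lam"
        then have "t \<le> deviation X / lam" using lam by (simp add: field_simps)
        then show "t ^ (2 * p) \<le> (deviation X / lam) ^ (2 * p)" using t by (intro power_mono) auto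
      qed
    qed measurable
    also have "\<dots> \<le> \<beta> / t ^ (2 * p)"
      unfolding \<beta>_def using t di by (intro integral_Markov_inequality_measure[where A = "{}"]) auto
    also have "\<dots> \<le> 2 * c / t ^ (2 * p)"
      using \<beta>c t by (intro divide_right_mono) auto
    also have "\<dots> = 2 * w'" using t by (simp add: cw)
    also have "\<dots> \<le> 2 powr (3/4) * real n * exp (- (y / 21))" using w by (simp add: w'_def)
    finally show ?thesis unfolding y21 .
  qed
qed

end

subsection \<open>Sampling in reproducing kernel Hilbert spaces\<close>

lemma cSUP_eq_dense:
  fixes \<phi> :: "'b \<Rightarrow> real"
  assumes "F \<subseteq> U" "F \<noteq> {}" "bdd_above (\<phi> ` U)"
    and "\<And>f \<eta>. f \<in> U \<Longrightarrow> \<eta> > 0 \<Longrightarrow> \<exists>c\<in>F. \<phi> f \<le> \<phi> c + \<eta>"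
  shows "(SUP f\<in>U. \<phi> f) = (SUP f\<in>F. \<phi> f)"
proof (rule antisym)
  have bF: "bdd_above (\<phi> ` F)" using assms(1,3) by (meson bdd_above_mono image_mono)
  show "(SUP f\<in>U. \<phi> f) \<le> (SUP f\<in>F. \<phi> f)"
  proof (rule cSUP_least)
    show "U \<noteq> {}" using assms(1,2) by auto
    fix f assume f: "f \<in> U"
    show "\<phi> f \<le> (SUP f\<in>F. \<phi> f)"
    proof (rule field_le_epsilon)
      fix \<eta> :: real assume "\<eta> > 0"
      then obtain c where "c \<in> F" "\<phi> f \<le> \<phi> c + \<eta>" using assms(4)[OF f] by blast
      then show "\<phi> f \<le> (SUP f\<in>F. \<phi> f) + \<eta>" using cSUP_upper[OF _ bF] by fastforce
    qed
  qed
  show "(SUP f\<in>F. \<phi> f) \<le> (SUP f\<in>U. \<phi> f)" by (rule cSUP_subset_mono[OF assms(2,3,1)]) simp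
qed

lemma cSUP_power_le:
  fixes \<phi> :: "'b \<Rightarrow> real"
  assumes "F \<noteq> {}" "m > 0" "\<And>f. f \<in> F \<Longrightarrow> 0 \<le> \<phi> f \<and> \<phi> f ^ m \<le> b"
  shows "(SUP f\<in>F. \<phi> f) ^ m \<le> b"
proof -
  obtain f0 where f0: "f0 \<in> F" using assms(1) by blast
  have b: "0 \<le> b" using assms(3)[OF f0] by (meson order_trans zero_le_power)
  have le: "\<phi> f \<le> root m b" if "f \<in> F" for f
    using assms(2) assms(3)[OF that] real_root_le_mono[of m "\<phi> f ^ m" b] by (simp add: real_root_power_cancel)
  then have "(SUP f\<in>F. \<phi> f) \<le> root m b" by (intro cSUP_least assms(1))
  moreover have "0 \<le> (SUP f\<in>F. \<phi> f)"
    using assms(3)[OF f0] le f0 by (intro cSUP_upper2[where x = f0] bdd_aboveI2) auto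
  ultimately have "(SUP f\<in>F. \<phi> f) ^ m \<le> root m b ^ m" by (intro power_mono)
  then show ?thesis using assms(2) b by simp
qed

context rkhs
begin

section \<open>Kernel sections and countable approximation of the unit ball\<close>

abbreviation kernel_section :: "'a \<Rightarrow> 'a \<Rightarrow> complex"
  where "kernel_section y \<equiv> (\<lambda>x. if x \<in> D then K x y else 0)"

lemma ip_kernel_section_self: "y \<in> D \<Longrightarrow> ip (kernel_section y) (kernel_section y) = K y y"
  using reproducing[OF section_mem, of y y] by simp

lemma kernel_diag_le:
  assumes bdd: "bdd_above ((\<lambda>x. sqrt (Re (K x x))) ` D)" and y: "y \<in> D"
  shows "0 \<le> kernel_sup D K" "Re (K y y) \<le> (kernel_sup D K)\<^sup>2"
proof -
  have nn: "0 \<le> Re (K y y)"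
    using ip_nonneg[OF section_mem[OF y]] by (simp only: ip_kernel_section_self[OF y])
  have le: "sqrt (Re (K y y)) \<le> kernel_sup D K"
    unfolding kernel_sup_def using cSUP_upper[OF y bdd] by simp
  then show "0 \<le> kernel_sup D K" using nn by (meson order_trans real_sqrt_ge_zero)
  show "Re (K y y) \<le> (kernel_sup D K)\<^sup>2" using le nn by (metis real_sqrt_le_iff real_sqrt_unique sqrt_le_D)
qed

lemma cmod_le_norm_kernel_sup:
  assumes bdd: "bdd_above ((\<lambda>x. sqrt (Re (K x x))) ` D)" and f: "f \<in> H" and y: "y \<in> D"
  shows "cmod (f y) \<le> ip_norm ip f * kernel_sup D K"
proof -
  have "cmod (f y) \<le> ip_norm ip f * ip_norm ip (kernel_section y)"
    using reproducing[OF f y] Cauchy_Schwarz[OF f section_mem[OF y]] by simp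
  also have "ip_norm ip (kernel_section y) = sqrt (Re (K y y))"
    by (simp only: ip_norm_def ip_kernel_section_self[OF y])
  also have "ip_norm ip f * \<dots> \<le> ip_norm ip f * kernel_sup D K"
    unfolding kernel_sup_def using cSUP_upper[OF y bdd] ip_nonneg[OF f]
    by (intro mult_left_mono) (auto simp: ip_norm_def)
  finally show ?thesis .
qed

lemma ip_norm_scale: "f \<in> H \<Longrightarrow> ip_norm ip (\<lambda>x. of_real r * f x) = \<bar>r\<bar> * ip_norm ip f"
  using ip_scale[of f "\<lambda>x. of_real r * f x" "of_real r"] ip_scale_right[of f f "of_real r"] mem_scale[of f]
  by (simp add: ip_norm_def real_sqrt_mult mult.assoc[symmetric] flip: power2_eq_square)

text \<open>Points of a dense set close to a unit vector may lie outside the ball, so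
  \<open>f\<close> is first shrunk by \<open>1 - e\<close>. Norm closeness becomes uniform closeness
  because point evaluations are bounded by \<open>kernel_sup D K\<close>.\<close>

lemma countable_dense_unit_ball:
  assumes sep: "ip_separable H ip" and bdd: "bdd_above ((\<lambda>x. sqrt (Re (K x x))) ` D)"
  shows "\<exists>F. countable F \<and> F \<subseteq> unit_ball H ip \<and>
    (\<forall>f\<in>unit_ball H ip. \<forall>\<delta>>0. \<exists>c\<in>F. \<forall>x\<in>D. cmod (f x - c x) \<le> \<delta>)"
proof -
  interpret MS: Metric_space H "ip_dist H ip" by (rule Metric_space_ip_dist)
  obtain C where C: "countable C" "C \<subseteq> H" "MS.mtopology closure_of C = H"
    using sep unfolding ip_separable_def separable_space_def by auto
  let ?F = "C \<inter> unit_ball H ip"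
  define \<kappa> where "\<kappa> = kernel_sup D K"
  have "\<exists>c\<in>?F. \<forall>x\<in>D. cmod (f x - c x) \<le> \<delta>" if f: "f \<in> unit_ball H ip" and \<delta>: "\<delta> > 0" for f \<delta>
  proof (cases "D = {}")
    \<comment> \<open>For empty \<open>D\<close> the supremum \<open>\<kappa>\<close> carries no
      sign information; but then every function in \<open>H\<close> is zero.\<close>
    case True
    have "H \<noteq> {}" using mem_zero by auto
    then obtain c where c: "c \<in> C" using C(3) by force
    then have "c = 0" using C(2) vanish_outside True by (auto simp: fun_eq_iff)
    then have "c \<in> ?F" using c mem_zero ip_zero_left[OF mem_zero] by (simp add: unit_ball_iff)
    then show ?thesis using True by blast
  next
    case False
    then have \<kappa>0: "0 \<le> \<kappa>" using kernel_diag_le(1)[OF bdd] by (auto simp: \<kappa>_def)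
    have fH: "f \<in> H" and f1: "ip_norm ip f \<le> 1" using f by (auto simp: unit_ball_def)
    \<comment> \<open>Shrinking and approximating each cost at most \<open>e * \<kappa>\<close>
      pointwise. The summand 1 avoids division by zero, and the minimum keeps \<open>1 - e\<close>
      nonnegative.\<close>
    define e where "e = min 1 (\<delta> / (2 * \<kappa> + 1))"
    have "e \<le> \<delta> / (2 * \<kappa> + 1)" by (simp add: e_def)
    then have "e * (2 * \<kappa> + 1) \<le> \<delta>" using \<kappa>0 pos_le_divide_eq[of "2 * \<kappa> + 1" e \<delta>] by simp
    moreover have "0 < e" "e \<le> 1" using \<delta> \<kappa>0 by (simp_all add: e_def)
    ultimately have e: "0 < e" "e \<le> 1" "e * (2 * \<kappa> + 1) \<le> \<delta>" by simp_all
    define h where "h = (\<lambda>x. of_real (1 - e) * f x)"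
    have hH: "h \<in> H" unfolding h_def by (rule mem_scale[OF fH])
    have h1: "ip_norm ip h \<le> 1 - e"
      unfolding h_def ip_norm_scale[OF fH] using e f1 by (simp add: mult_left_le)
    have "h \<in> MS.mtopology closure_of C" using hH C(3) by simp
    then obtain c where c: "c \<in> C" "ip_dist H ip h c < e"
      using e(1) unfolding MS.metric_closure_of by fastforce
    have cH: "c \<in> H" using c C by auto
    have d: "ip_norm ip (h - c) < e" using c hH cH by (simp add: ip_dist_def)
    have "ip_norm ip (h + (c - h)) \<le> ip_norm ip h + ip_norm ip (c - h)"
      by (rule ip_norm_triangle[OF hH mem_diff[OF cH hH]])
    then have "ip_norm ip c \<le> 1" using h1 d ip_norm_minus_commute[OF hH cH] by simp
    then have "c \<in> ?F" using c cH by (simp add: unit_ball_def)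
    moreover have "cmod (f x - c x) \<le> \<delta>" if x: "x \<in> D" for x
    proof -
      have "f x - c x = of_real e * f x + (h - c) x" by (simp add: h_def algebra_simps)
      then have "cmod (f x - c x) \<le> cmod (of_real e * f x) + cmod ((h - c) x)"
        using norm_triangle_ineq by metis
      also have "\<dots> \<le> e * \<kappa> + e * \<kappa>"
      proof (rule add_mono)
        have "cmod (f x) \<le> \<kappa>" using norm_le_kernel_sup[OF bdd f x] by (simp add: \<kappa>_def)
        then show "cmod (of_real e * f x) \<le> e * \<kappa>" using e by (simp add: norm_mult mult_left_mono)
        have "cmod ((h - c) x) \<le> ip_norm ip (h - c) * \<kappa>"
          unfolding \<kappa>_def by (rule cmod_le_norm_kernel_sup[OF bdd mem_diff[OF hH cH] x])
        also have "\<dots> \<le> e * \<kappa>" using d \<kappa>0 by (intro mult_right_mono) auto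
        finally show "cmod ((h - c) x) \<le> e * \<kappa>" .
      qed
      also have "\<dots> \<le> \<delta>" using e by (simp add: algebra_simps)
      finally show ?thesis .
    qed
    ultimately show ?thesis by blast
  qed
  then show ?thesis using C(1) by (intro exI[of _ ?F]) auto
qed

end

section \<open>Random nodes and the deviation over the unit ball\<close>

locale rkhs_sampling = rkhs D H ip K + prob_space \<rho>
  for D :: "'a set" and H :: "('a \<Rightarrow> complex) set"
    and ip :: "('a \<Rightarrow> complex) \<Rightarrow> ('a \<Rightarrow> complex) \<Rightarrow> complex"
    and K :: "'a \<Rightarrow> 'a \<Rightarrow> complex" and \<rho> :: "'a measure" +
  fixes n :: nat and F :: "('a \<Rightarrow> complex) set"
  assumes space_rho: "space \<rho> = D" and measurable_H: "f \<in> H \<Longrightarrow> f \<in> borel_measurable \<rho>"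
    and bdd: "bdd_above ((\<lambda>x. sqrt (Re (K x x))) ` D)" and n1: "n \<ge> 1"
    and F_countable: "countable F" and F_ball: "F \<subseteq> unit_ball H ip"
    and F_dense: "f \<in> unit_ball H ip \<Longrightarrow> \<delta> > 0 \<Longrightarrow> \<exists>c\<in>F. \<forall>x\<in>D. cmod (f x - c x) \<le> \<delta>"
begin

abbreviation \<kappa> where "\<kappa> \<equiv> kernel_sup D K"
abbreviation lam where "lam \<equiv> (embedding_norm H ip \<rho>)\<^sup>2"

lemma D_ne: "D \<noteq> {}" using not_empty space_rho by simp

lemma kappa_nonneg: "0 \<le> \<kappa>" using D_ne kernel_diag_le(1)[OF bdd] by blast

lemma zero_ball: "0 \<in> unit_ball H ip"
  using mem_zero ip_zero_left[OF mem_zero] by (simp add: unit_ball_iff)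

lemma F_nonempty: "F \<noteq> {}" using F_dense[OF zero_ball, of 1] by auto

lemma ball_bound: "f \<in> unit_ball H ip \<Longrightarrow> x \<in> D \<Longrightarrow> (cmod (f x))\<^sup>2 \<le> \<kappa>\<^sup>2"
  by (intro power_mono norm_le_kernel_sup[OF bdd]) auto

lemma ball_measurable: "f \<in> unit_ball H ip \<Longrightarrow> (\<lambda>x. (cmod (f x))\<^sup>2) \<in> borel_measurable \<rho>"
  using measurable_H[of f] by (simp add: unit_ball_def)

sublocale bc: bounded_class \<rho> F "\<lambda>f x. (cmod (f x))\<^sup>2" "\<kappa>\<^sup>2" n
proof
  show "0 \<le> (cmod (f x))\<^sup>2 \<and> (cmod (f x))\<^sup>2 \<le> \<kappa>\<^sup>2" if "f \<in> F" "x \<in> space \<rho>" for f x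
    using ball_bound[OF subsetD[OF F_ball that(1)]] that(2) space_rho by simp
qed (fact F_countable F_nonempty n1 | rule ball_measurable, erule subsetD[OF F_ball])+

lemma ball_integrable:
  assumes f: "f \<in> unit_ball H ip" shows "integrable \<rho> (\<lambda>x. (cmod (f x))\<^sup>2)"
  using ball_bound[OF f] ball_measurable[OF f] space_rho
  by (intro integrable_const_bound[where B = "\<kappa>\<^sup>2"]) auto

lemma ball_mean_le:
  assumes f: "f \<in> unit_ball H ip"
  shows "0 \<le> (LINT x|\<rho>. (cmod (f x))\<^sup>2)" "(LINT x|\<rho>. (cmod (f x))\<^sup>2) \<le> \<kappa>\<^sup>2"
proof -
  show "0 \<le> (LINT x|\<rho>. (cmod (f x))\<^sup>2)" by simp
  have "(LINT x|\<rho>. (cmod (f x))\<^sup>2) \<le> (LINT x|\<rho>. \<kappa>\<^sup>2)"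
    using ball_bound[OF f] space_rho ball_integrable[OF f] by (intro integral_mono) auto
  then show "(LINT x|\<rho>. (cmod (f x))\<^sup>2) \<le> \<kappa>\<^sup>2" by (simp add: prob_space)
qed

lemma embedding_norm_bounds:
  "0 \<le> embedding_norm H ip \<rho>" "embedding_norm H ip \<rho> \<le> \<kappa>"
  "f \<in> unit_ball H ip \<Longrightarrow> (LINT x|\<rho>. (cmod (f x))\<^sup>2) \<le> lam"
proof -
  have le: "sqrt (LINT x|\<rho>. (cmod (f x))\<^sup>2) \<le> \<kappa>" if "f \<in> unit_ball H ip" for f
    using ball_mean_le(2)[OF that] kappa_nonneg by (intro real_le_lsqrt) auto
  then have bdd': "bdd_above ((\<lambda>f. sqrt (LINT x|\<rho>. (cmod (f x))\<^sup>2)) ` unit_ball H ip)"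
    by (intro bdd_aboveI2)
  have up: "sqrt (LINT x|\<rho>. (cmod (f x))\<^sup>2) \<le> embedding_norm H ip \<rho>" if "f \<in> unit_ball H ip" for f
    unfolding embedding_norm_def by (rule cSUP_upper[OF that bdd'])
  show nn: "0 \<le> embedding_norm H ip \<rho>" using up[OF zero_ball] by simp
  show "embedding_norm H ip \<rho> \<le> \<kappa>"
    unfolding embedding_norm_def using zero_ball le by (intro cSUP_least) auto
  show "f \<in> unit_ball H ip \<Longrightarrow> (LINT x|\<rho>. (cmod (f x))\<^sup>2) \<le> lam"
    using up by (simp add: sqrt_le_D)
qed

lemma lam_le: "lam \<le> \<kappa>\<^sup>2"
  using embedding_norm_bounds(1,2) by (intro power_mono)

lemma node_mem: "X \<in> space (node_measure n \<rho>) \<Longrightarrow> i \<in> {1..n} \<Longrightarrow> X i \<in> D"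
  using space_rho by (auto simp: space_PiM)

lemma ball_deviation_le:
  assumes X: "X \<in> space (node_measure n \<rho>)" and f: "f \<in> unit_ball H ip"
  shows "\<bar>(LINT x|\<rho>. (cmod (f x))\<^sup>2) - 1 / real n * (\<Sum>i\<in>{1..n}. (cmod (f (X i)))\<^sup>2)\<bar> \<le> \<kappa>\<^sup>2"
proof -
  have "\<bar>1 / real n * (\<Sum>i\<in>{1..n}. (cmod (f (X i)))\<^sup>2)\<bar> \<le> \<kappa>\<^sup>2"
    using ball_bound[OF f node_mem[OF X]] by (intro bc.average_abs_le) auto
  moreover have "0 \<le> 1 / real n * (\<Sum>i\<in>{1..n}. (cmod (f (X i)))\<^sup>2)"
    by (intro mult_nonneg_nonneg sum_nonneg) auto
  ultimately show ?thesis using ball_mean_le[OF f] by linarith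
qed

text \<open>Uniform closeness on \<open>D\<close> moves both the integral and the empirical average
  only slightly, so the countable part already attains the supremum. This is the source of
  measurability.\<close>

lemma worst_deviation_eq:
  assumes X: "X \<in> space (node_measure n \<rho>)"
  shows "worst_deviation H ip \<rho> n X = bc.deviation X"
  unfolding worst_deviation_def bc.deviation_def
proof (rule cSUP_eq_dense[OF F_ball F_nonempty])
  let ?dev = "\<lambda>f. \<bar>(LINT x|\<rho>. (cmod (f x))\<^sup>2) - 1 / real n * (\<Sum>i\<in>{1..n}. (cmod (f (X i)))\<^sup>2)\<bar>"
  show "bdd_above (?dev ` unit_ball H ip)"
    using ball_deviation_le[OF X] by (intro bdd_aboveI2)
  fix f :: "'a \<Rightarrow> complex" and \<eta> :: real assume f: "f \<in> unit_ball H ip" and \<eta>: "\<eta> > 0"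
  \<comment> \<open>The integral and the empirical average each change by at most
    \<open>2 * \<kappa> * \<delta>\<close>; the summand 1 covers
    \<open>\<kappa> = 0\<close>.\<close>
  define \<delta> where "\<delta> = \<eta> / (4 * \<kappa> + 1)"
  have \<delta>: "\<delta> > 0" "4 * \<kappa> * \<delta> \<le> \<eta>" using \<eta> kappa_nonneg by (auto simp: \<delta>_def field_simps)
  obtain c where c: "c \<in> F" and close: "\<And>x. x \<in> D \<Longrightarrow> cmod (f x - c x) \<le> \<delta>"
    using F_dense[OF f \<delta>(1)] by blast
  have cb: "c \<in> unit_ball H ip" using c F_ball by blast
  have sq: "\<bar>(cmod (f x))\<^sup>2 - (cmod (c x))\<^sup>2\<bar> \<le> 2 * \<kappa> * \<delta>" if x: "x \<in> D" for x
  proof -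
    have "\<bar>(cmod (f x))\<^sup>2 - (cmod (c x))\<^sup>2\<bar> = (cmod (f x) + cmod (c x)) * \<bar>cmod (f x) - cmod (c x)\<bar>"
      by (simp add: power2_eq_square square_diff_square_factored abs_mult)
    also have "\<dots> \<le> (\<kappa> + \<kappa>) * \<delta>"
      using norm_le_kernel_sup[OF bdd f x] norm_le_kernel_sup[OF bdd cb x] kappa_nonneg
        order_trans[OF norm_triangle_ineq3 close[OF x]]
      by (intro mult_mono add_mono) auto
    finally show ?thesis by simp
  qed
  have "\<bar>(LINT x|\<rho>. (cmod (f x))\<^sup>2) - (LINT x|\<rho>. (cmod (c x))\<^sup>2)\<bar> \<le> 2 * \<kappa> * \<delta>"
  proof -
    have "\<bar>LINT x|\<rho>. (cmod (f x))\<^sup>2 - (cmod (c x))\<^sup>2\<bar> \<le> (LINT x|\<rho>. \<bar>(cmod (f x))\<^sup>2 - (cmod (c x))\<^sup>2\<bar>)"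
      by (rule integral_abs_bound)
    also have "\<dots> \<le> (LINT x|\<rho>. 2 * \<kappa> * \<delta>)"
      using ball_integrable[OF f] ball_integrable[OF cb] sq space_rho by (intro integral_mono) auto
    finally show ?thesis using ball_integrable[OF f] ball_integrable[OF cb] by (simp add: prob_space)
  qed
  moreover have "\<bar>1 / real n * (\<Sum>i\<in>{1..n}. (cmod (f (X i)))\<^sup>2) - 1 / real n * (\<Sum>i\<in>{1..n}. (cmod (c (X i)))\<^sup>2)\<bar>
      \<le> 2 * \<kappa> * \<delta>"
    using bc.average_abs_le[of "\<lambda>i. (cmod (f (X i)))\<^sup>2 - (cmod (c (X i)))\<^sup>2", OF sq[OF node_mem[OF X]]]
    by (simp add: sum_subtractf right_diff_distrib diff_divide_distrib)
  ultimately have "?dev f \<le> ?dev c + \<eta>" using \<delta>(2) by linarith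
  then show "\<exists>c\<in>F. ?dev f \<le> ?dev c + \<eta>" using c by blast
qed

text \<open>On the unit ball the empirical mean exceeds the true mean by at most the deviation, and
  scaling extends this to \<open>H\<close>. Here the deviation enters its own moment bound.\<close>

lemma sample_norm_le:
  assumes X: "X \<in> space (node_measure n \<rho>)" and f: "f \<in> H"
  shows "(\<Sum>i\<in>{1..n}. (cmod (f (X i)))\<^sup>2) \<le> real n * (lam + bc.deviation X) * Re (ip f f)"
proof (cases "ip f f = 0")
  case True
  then show ?thesis using ip_definite[OF f] by simp
next
  case False
  have unit: "(\<Sum>i\<in>{1..n}. (cmod (h (X i)))\<^sup>2) \<le> real n * (lam + bc.deviation X)"
    if h: "h \<in> unit_ball H ip" for h
  proof -
    have "\<bar>(LINT x|\<rho>. (cmod (h x))\<^sup>2) - 1 / real n * (\<Sum>i\<in>{1..n}. (cmod (h (X i)))\<^sup>2)\<bar> \<le> bc.deviation X"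
      unfolding worst_deviation_eq[OF X, symmetric] worst_deviation_def
      using ball_deviation_le[OF X] h by (intro cSUP_upper bdd_aboveI2)
    then have "1 / real n * (\<Sum>i\<in>{1..n}. (cmod (h (X i)))\<^sup>2) \<le> lam + bc.deviation X"
      using embedding_norm_bounds(3)[OF h] by linarith
    then show ?thesis using n1 by (simp add: field_simps)
  qed
  define r where "r = ip_norm ip f"
  have "Re (ip f f) \<noteq> 0" using False ip_self[OF f] by (metis of_real_0)
  then have r: "r > 0" "Re (ip f f) = r\<^sup>2" using ip_nonneg[OF f] by (auto simp: r_def ip_norm_def)
  define h where "h = (\<lambda>x. of_real (1 / r) * f x)"
  have hH: "h \<in> H" unfolding h_def by (rule mem_scale[OF f])
  have "ip_norm ip h = \<bar>1 / r\<bar> * ip_norm ip f" unfolding h_def by (rule ip_norm_scale[OF f])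
  then have hb: "h \<in> unit_ball H ip" using r hH by (simp add: unit_ball_def r_def)
  have "(\<Sum>i\<in>{1..n}. (cmod (f (X i)))\<^sup>2) = r\<^sup>2 * (\<Sum>i\<in>{1..n}. (cmod (h (X i)))\<^sup>2)"
    unfolding sum_distrib_left
    using r by (intro sum.cong refl) (simp add: h_def norm_mult norm_divide power_mult_distrib power_divide)
  also have "\<dots> \<le> r\<^sup>2 * (real n * (lam + bc.deviation X))" by (intro mult_left_mono unit[OF hb]) simp
  finally show ?thesis unfolding r(2) by (simp only: mult_ac)
qed

text \<open>The Khintchine inequality for the kernel sections at the nodes, which turn inner
  products into point values. One factor \<open>n\<close> of \<open>s\<close> cancels against the
  normalisation \<open>n ^ (2 * p)\<close> in each of the \<open>p\<close> factors.\<close>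

lemma signed_sup_moment_le:
  assumes p: "p \<ge> 1" and X: "X \<in> space (node_measure n \<rho>)"
  shows "(\<Sum>\<epsilon>\<in>sign_vectors {1..n}. bc.signed_sup \<epsilon> X ^ (2 * p))
    \<le> 2 ^ n * (real n * odd_fact p * (\<kappa>\<^sup>2 * (lam + bc.deviation X) / real n) ^ p)"
proof -
  let ?y = "\<lambda>i. kernel_section (X i)" and ?s = "real n * (lam + bc.deviation X)"
  have rep: "cmod (ip f (?y i)) = cmod (f (X i))" if "f \<in> H" "i \<in> {1..n}" for f i
    by (simp only: reproducing[OF that(1) node_mem[OF X that(2)], symmetric])
  have s0: "0 \<le> ?s" using bc.deviation_bounds(1)[OF X] by simp
  have 1: "?y i \<in> H" if "i \<in> {1..n}" for i by (rule section_mem[OF node_mem[OF X that]])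
  have 2: "Re (ip (?y i) (?y i)) \<le> \<kappa>\<^sup>2" if "i \<in> {1..n}" for i
    unfolding ip_kernel_section_self[OF node_mem[OF X that]] by (rule kernel_diag_le(2)[OF bdd node_mem[OF X that]])
  have 3: "(\<Sum>i\<in>{1..n}. (cmod (ip f (?y i)))\<^sup>2) \<le> ?s * Re (ip f f)" if "f \<in> H" for f
    using sample_norm_le[OF X that] rep[OF that] by (simp only: cong: sum.cong)
  have "\<exists>T. (\<forall>\<epsilon>. \<forall>f\<in>unit_ball H ip. \<bar>\<Sum>i\<in>{1..n}. \<epsilon> i * (cmod (ip f (?y i)))\<^sup>2\<bar> ^ (2 * p) \<le> T \<epsilon>)
    \<and> (\<Sum>\<epsilon>\<in>sign_vectors {1..n}. T \<epsilon>)
      \<le> 2 ^ card {1..n} * real (card {1..n}) * odd_fact p * (\<kappa>\<^sup>2 * ?s) ^ p"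
    by (rule rank_one_Khintchine[OF finite_atLeastAtMost 1 2 zero_le_power2 3 s0 p])
  then obtain T where T: "\<forall>\<epsilon>. \<forall>f\<in>unit_ball H ip. \<bar>\<Sum>i\<in>{1..n}. \<epsilon> i * (cmod (ip f (?y i)))\<^sup>2\<bar> ^ (2 * p) \<le> T \<epsilon>"
    and Tsum: "(\<Sum>\<epsilon>\<in>sign_vectors {1..n}. T \<epsilon>)
      \<le> 2 ^ card {1..n} * real (card {1..n}) * odd_fact p * (\<kappa>\<^sup>2 * ?s) ^ p"
    by (elim exE conjE)
  have "bc.signed_sup \<epsilon> X ^ (2 * p) \<le> T \<epsilon> / real n ^ (2 * p)" for \<epsilon>
    unfolding bc.signed_sup_def
  proof (rule cSUP_power_le[OF F_nonempty])
    fix f assume "f \<in> F"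
    then have f: "f \<in> unit_ball H ip" "f \<in> H" using F_ball by (auto simp: unit_ball_def)
    have "(\<Sum>i\<in>{1..n}. \<epsilon> i * (cmod (ip f (?y i)))\<^sup>2) = (\<Sum>i\<in>{1..n}. \<epsilon> i * (cmod (f (X i)))\<^sup>2)"
      using rep[OF f(2)] by (intro sum.cong refl) simp
    then have "\<bar>\<Sum>i\<in>{1..n}. \<epsilon> i * (cmod (f (X i)))\<^sup>2\<bar> ^ (2 * p) \<le> T \<epsilon>"
      using bspec[OF spec[OF T, of \<epsilon>] f(1)] by (simp only:)
    then have "\<bar>\<Sum>i\<in>{1..n}. \<epsilon> i * (cmod (f (X i)))\<^sup>2\<bar> ^ (2 * p) / real n ^ (2 * p) \<le> T \<epsilon> / real n ^ (2 * p)"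
      by (intro divide_right_mono) auto
    then show "0 \<le> \<bar>1 / real n * (\<Sum>i\<in>{1..n}. \<epsilon> i * (cmod (f (X i)))\<^sup>2)\<bar> \<and>
        \<bar>1 / real n * (\<Sum>i\<in>{1..n}. \<epsilon> i * (cmod (f (X i)))\<^sup>2)\<bar> ^ (2 * p) \<le> T \<epsilon> / real n ^ (2 * p)"
      by (simp add: power_divide)
  qed (use p in simp)
  then have "(\<Sum>\<epsilon>\<in>sign_vectors {1..n}. bc.signed_sup \<epsilon> X ^ (2 * p))
      \<le> (\<Sum>\<epsilon>\<in>sign_vectors {1..n}. T \<epsilon>) / real n ^ (2 * p)"
    unfolding sum_divide_distrib by (intro sum_mono)
  also have "\<dots> \<le> 2 ^ n * real n * odd_fact p * (\<kappa>\<^sup>2 * ?s) ^ p / real n ^ (2 * p)"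
    using Tsum by (intro divide_right_mono) auto
  also have "\<dots> = 2 ^ n * (real n * odd_fact p * (\<kappa>\<^sup>2 * (lam + bc.deviation X) / real n) ^ p)"
  proof -
    have "\<kappa>\<^sup>2 * ?s / (real n)\<^sup>2 = \<kappa>\<^sup>2 * (lam + bc.deviation X) / real n"
      using n1 by (simp add: power2_eq_square)
    then have "(\<kappa>\<^sup>2 * ?s) ^ p / real n ^ (2 * p) = (\<kappa>\<^sup>2 * (lam + bc.deviation X) / real n) ^ p"
      by (simp only: power_mult power_divide[symmetric])
    then show ?thesis by (simp only: mult.assoc times_divide_eq_right[symmetric])
  qed
  finally show ?thesis .
qed

lemma worst_deviation_measurable: "worst_deviation H ip \<rho> n \<in> borel_measurable (node_measure n \<rho>)"
  using bc.deviation_meas by (subst measurable_cong[OF worst_deviation_eq])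

lemma worst_deviation_sets:
  "{X \<in> space (node_measure n \<rho>). worst_deviation H ip \<rho> n X > a} \<in> sets (node_measure n \<rho>)"
  using worst_deviation_measurable by measurable

lemma worst_deviation_set:
  "{X \<in> space (node_measure n \<rho>). worst_deviation H ip \<rho> n X > a}
    = {X \<in> space (node_measure n \<rho>). bc.deviation X > a}"
  using worst_deviation_eq by auto

lemma worst_deviation_tail:
  assumes t: "0 < t" "t \<le> 1"
  shows "measure (node_measure n \<rho>) {X \<in> space (node_measure n \<rho>). worst_deviation H ip \<rho> n X > t * lam}
    \<le> 2 powr (3 / 4) * real n * exp (- (real n * t\<^sup>2 * lam / (21 * \<kappa>\<^sup>2)))"
proof (cases "lam = 0")
  \<comment> \<open>The exponent vanishes, and \<open>2 powr (3/4) * n\<close> is at least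
    1.\<close>
  case True
  interpret P: prob_space "node_measure n \<rho>" by (rule bc.prob_space_nodes)
  have "(1::real) \<le> 2 powr (3/4)" by (rule ge_one_powr_ge_zero) auto
  then have "1 * 1 \<le> 2 powr (3/4) * real n" using n1 by (intro mult_mono) auto
  then show ?thesis using True P.prob_le_1 order_trans by auto
next
  case False
  then have "lam > 0" by simp
  then show ?thesis unfolding worst_deviation_set
    by (intro bc.deviation_tail lam_le t signed_sup_moment_le)
qed

text \<open>With \<open>lam = 0\<close> the condition on \<open>n\<close> in the second part holds
  since division by zero yields 0, and the claimed bound is 0. Zero mean makes each \<open>f\<close>
  in \<open>F\<close> vanish almost everywhere, and countability gives one common null set.\<close>

lemma worst_deviation_AE_zero:
  assumes "lam = 0"
  shows "AE X in node_measure n \<rho>. worst_deviation H ip \<rho> n X \<le> 0"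
proof -
  have mean0: "(LINT x|\<rho>. (cmod (f x))\<^sup>2) = 0" if "f \<in> F" for f
    using embedding_norm_bounds(3)[OF subsetD[OF F_ball that]] ball_mean_le(1)[OF subsetD[OF F_ball that]]
    unfolding assms by (rule antisym)
  have ae: "AE x in \<rho>. \<forall>f\<in>F. (cmod (f x))\<^sup>2 = 0"
  proof (rule AE_ball_countable'[OF _ F_countable])
    fix f assume f: "f \<in> F"
    then have "integrable \<rho> (\<lambda>x. (cmod (f x))\<^sup>2)" using F_ball by (intro ball_integrable) auto
    then show "AE x in \<rho>. (cmod (f x))\<^sup>2 = 0"
      using mean0[OF f] by (subst (asm) integral_nonneg_eq_0_iff_AE) auto
  qed
  have "AE X in node_measure n \<rho>. \<forall>i\<in>{1..n}. \<forall>f\<in>F. (cmod (f (X i)))\<^sup>2 = 0"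
  proof (rule AE_finite_allI[OF finite_atLeastAtMost])
    fix i assume "i \<in> {1..n}"
    then show "AE X in node_measure n \<rho>. \<forall>f\<in>F. (cmod (f (X i)))\<^sup>2 = 0"
      by (rule AE_PiM_component[where M = "\<lambda>_. \<rho>" and P = "\<lambda>x. \<forall>f\<in>F. (cmod (f x))\<^sup>2 = 0",
            OF prob_space_axioms _ ae])
  qed
  then show ?thesis using AE_space
  proof eventually_elim
    case (elim X)
    have "bc.deviation X \<le> 0"
      unfolding bc.deviation_def
    proof (rule cSUP_least[OF F_nonempty])
      fix f assume f: "f \<in> F"
      have "(\<Sum>i\<in>{1..n}. (cmod (f (X i)))\<^sup>2) = 0"
        using elim(1) f by (intro sum.neutral) blast
      then show "\<bar>(LINT x|\<rho>. (cmod (f x))\<^sup>2) - 1 / real n * (\<Sum>i\<in>{1..n}. (cmod (f (X i)))\<^sup>2)\<bar> \<le> 0"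
        using mean0[OF f] by simp
    qed
    then show ?case using worst_deviation_eq[OF elim(2)] by simp
  qed
qed

lemma worst_deviation_high_probability:
  fixes r :: real
  assumes r: "r > 1" and n2: "n \<ge> 2"
    and large: "real n / ln (real n) \<ge> 21 * r * \<kappa>\<^sup>2 / lam"
  shows "measure (node_measure n \<rho>) {X \<in> space (node_measure n \<rho>). worst_deviation H ip \<rho> n X
      \<le> embedding_norm H ip \<rho> * \<kappa> * sqrt (21 * r * ln (real n) / real n)}
    > 1 - 2 * real n powr (1 - r)"
proof -
  let ?P = "node_measure n \<rho>" and ?b = "embedding_norm H ip \<rho> * \<kappa> * sqrt (21 * r * ln (real n) / real n)"
  interpret P: prob_space ?P by (rule bc.prob_space_nodes)
  note [measurable] = worst_deviation_measurable
  have ln0: "ln (real n) > 0" using n2 by simp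
  show ?thesis
  proof (cases "lam = 0")
    case True
    then have "AE X in ?P. worst_deviation H ip \<rho> n X \<le> ?b"
      using worst_deviation_AE_zero by simp
    then have "measure ?P {X \<in> space ?P. worst_deviation H ip \<rho> n X \<le> ?b} = 1"
      by (subst P.prob_Collect_eq_1) measurable
    moreover have "real n powr (1 - r) > 0" using n2 by simp
    ultimately show ?thesis by simp
  next
    case False
    define N where "N = embedding_norm H ip \<rho>"
    have N: "N > 0" "N \<le> \<kappa>" using False embedding_norm_bounds(1,2) by (auto simp: N_def less_le)
    then have \<kappa>: "\<kappa> > 0" by simp
    define q where "q = 21 * r * ln (real n) / real n"
    have q: "q > 0" using r ln0 n2 by (simp add: q_def)
    \<comment> \<open>Chosen so that \<open>t * lam\<close> is the claimed bound and the exponent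
      becomes \<open>r * ln n\<close>; the condition on \<open>n\<close> then says
      \<open>t <= 1\<close>.\<close>
    define t where "t = \<kappa> / N * sqrt q"
    have t0: "t > 0" using \<kappa> N q by (simp add: t_def)
    have t2: "t\<^sup>2 = \<kappa>\<^sup>2 / N\<^sup>2 * q" using q by (simp add: t_def power_mult_distrib power_divide)
    have "21 * r * \<kappa>\<^sup>2 / N\<^sup>2 * ln (real n) \<le> real n"
      using large ln0 by (simp add: N_def field_simps)
    then have "21 * r * \<kappa>\<^sup>2 / N\<^sup>2 * ln (real n) / real n \<le> 1" using n2 by (subst divide_le_eq_1_pos) simp_all
    moreover have "t\<^sup>2 = 21 * r * \<kappa>\<^sup>2 / N\<^sup>2 * ln (real n) / real n" by (simp add: t2 q_def)
    ultimately have "t\<^sup>2 \<le> 1" by (simp only:)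
    then have t1: "t \<le> 1" using t0 by (simp add: abs_square_le_1)
    have tb: "t * lam = ?b"
      using N by (simp add: t_def q_def N_def[symmetric] power2_eq_square)
    have ex: "real n * t\<^sup>2 * lam / (21 * \<kappa>\<^sup>2) = r * ln (real n)"
      using N \<kappa> n2 by (simp add: t2 q_def N_def[symmetric])
    have "measure ?P {X \<in> space ?P. worst_deviation H ip \<rho> n X > ?b}
        \<le> 2 powr (3 / 4) * real n * exp (- (r * ln (real n)))"
      using worst_deviation_tail[OF t0 t1] unfolding ex tb .
    also have "\<dots> = 2 powr (3 / 4) * real n powr (1 - r)"
    proof -
      have "(1 - r) * ln (real n) = ln (real n) + - (r * ln (real n))" by (simp add: algebra_simps)
      then have "real n powr (1 - r) = real n * exp (- (r * ln (real n)))"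
        using n2 by (simp only: powr_def exp_add exp_ln) simp
      then show ?thesis by (simp only: mult.assoc)
    qed
    also have "\<dots> < 2 * real n powr (1 - r)"
    proof (rule mult_strict_right_mono)
      \<comment> \<open>The slack between \<open>2 powr (3/4)\<close> and 2 makes the final
        probability bound strict.\<close>
      have "(2::real) powr (3/4) < 2 powr 1" by (subst powr_less_cancel_iff) auto
      then show "(2::real) powr (3/4) < 2" by simp
    qed (use n2 in simp)
    finally have "measure ?P {X \<in> space ?P. worst_deviation H ip \<rho> n X > ?b} < 2 * real n powr (1 - r)" .
    moreover have "measure ?P {X \<in> space ?P. worst_deviation H ip \<rho> n X \<le> ?b}
        = 1 - measure ?P {X \<in> space ?P. worst_deviation H ip \<rho> n X > ?b}"
    proof -
      have "{X \<in> space ?P. worst_deviation H ip \<rho> n X \<le> ?b}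
          = space ?P - {X \<in> space ?P. worst_deviation H ip \<rho> n X > ?b}" by auto
      then show ?thesis using P.prob_compl[OF worst_deviation_sets] by (simp only:)
    qed
    ultimately show ?thesis by simp
  qed
qed

end

theorem theorem6p1:
  fixes D :: "(real ^ 'd) set"
    and \<rho> :: "(real ^ 'd) measure"
    and K :: "real ^ 'd \<Rightarrow> real ^ 'd \<Rightarrow> complex"
    and H :: "(real ^ 'd \<Rightarrow> complex) set"
    and ip :: "(real ^ 'd \<Rightarrow> complex) \<Rightarrow> (real ^ 'd \<Rightarrow> complex) \<Rightarrow> complex"
    and n :: nat
  assumes "D \<in> sets borel"
    and "sets \<rho> = sets (restrict_space borel D)"
    and "prob_space \<rho>"
    and "pos_def_hermitian_kernel D K"
    and "rkhs D H ip K"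
    and "infinite_dimensional H"
    and "ip_separable H ip"
    and "\<forall>f\<in>H. f \<in> borel_measurable \<rho>"
    and "bdd_above ((\<lambda>x. sqrt (Re (K x x))) ` D)"
    and "n \<ge> 1"
  shows "(\<forall>t::real. 0 < t \<and> t \<le> 1 \<longrightarrow>
            {X \<in> space (node_measure n \<rho>).
               worst_deviation H ip \<rho> n X > t * (embedding_norm H ip \<rho>)\<^sup>2}
              \<in> sets (node_measure n \<rho>) \<and>
            measure (node_measure n \<rho>)
              {X \<in> space (node_measure n \<rho>).
                 worst_deviation H ip \<rho> n X > t * (embedding_norm H ip \<rho>)\<^sup>2}
              \<le> 2 powr (3 / 4) * real n *
                 exp (- (real n * t\<^sup>2 * (embedding_norm H ip \<rho>)\<^sup>2 / (21 * (kernel_sup D K)\<^sup>2)))) \<and>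
         (\<forall>r::real. r > 1 \<longrightarrow> n \<ge> 2 \<longrightarrow>
            real n / ln (real n) \<ge> 21 * r * (kernel_sup D K)\<^sup>2 / (embedding_norm H ip \<rho>)\<^sup>2 \<longrightarrow>
            measure (node_measure n \<rho>)
              {X \<in> space (node_measure n \<rho>).
                 worst_deviation H ip \<rho> n X
                   \<le> embedding_norm H ip \<rho> * kernel_sup D K * sqrt (21 * r * ln (real n) / real n)}
              > 1 - 2 * real n powr (1 - r))"
proof -
  interpret R: rkhs D H ip K by fact
  interpret prob_space \<rho> by fact
  obtain F where F: "countable F" "F \<subseteq> unit_ball H ip"
    "\<And>f \<delta>. f \<in> unit_ball H ip \<Longrightarrow> \<delta> > 0 \<Longrightarrow> \<exists>c\<in>F. \<forall>x\<in>D. cmod (f x - c x) \<le> \<delta>"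
    using R.countable_dense_unit_ball[OF assms(7,9)] by blast
  have "space \<rho> = D"
    using sets_eq_imp_space_eq[OF assms(2)] by (simp add: space_restrict_space)
  then interpret rkhs_sampling D H ip K \<rho> n F
    using assms(8-10) F by unfold_locales auto
  show ?thesis
    by (intro conjI allI impI worst_deviation_sets)
      (blast intro: worst_deviation_tail worst_deviation_high_probability)+
qed

end
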